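(* Fix $m\in\mathbb{N}$. Let $k=k(n)$ be a sequence of integers with $k(n)\ge m$ for all $n$, such that, as $n\to\infty$, $k(n)=o(\log n)$ if $m=1$, and $k(n)=o\left(\frac{\log n}{\log\log n}\right)$ if $m\ge 2$. Then, as $n\to\infty$, the random vector $$\left(\frac{T_m(n)-n\log n-(m-1)n\log\log n}{n},\ \frac{k!\,S_k}{(\log n)^{k-m+1}}\right)$$ converges in distribution to $\left(X,e^{-X}\right)$, where $X\sim\mathrm{Gumbel}(-\log((m-1)!),1)$.
   Context: Coupon collector problem: there are $n$ types of coupons. Coupons are collected one at a time; each collected coupon is, independently of the others, of each given type with probability $1/n$. Fix a positive integer $m$. One keeps collecting until at least $m$ copies of every one of the $n$ types have been collected, and then stops. $T_m(n)$ denotes the total number of coupons collected at the stopping time. For an integer $k\ge m$, a type of coupon is called a $k$-ton if exactly $k$ copies of it have been collected at the stopping time, and $S_k$ (which depends on $n$ and $m$) denotes the number of types that are $k$-tons. $\mathbb{N}$ denotes the positive integers and $\log$ the natural logarithm. $\mathrm{Gumbel}(\mu,\beta)$ denotes the probability distribution on $\mathbb{R}$ with cumulative distribution function $x\mapsto e^{-e^{-(x-\mu)/\beta}}$. *)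

theory Defs
  imports "HOL-Probability.Probability" "HOL-Library.Landau_Symbols"
begin

text \<open>
  The \<open>n\<close> coupon types are \<open>0, \<dots>, n - 1\<close>, and \<open>C i\<close> is the type of the \<open>(i + 1)\<close>-st collected
  coupon.
\<close>

locale coupon_collector = prob_space M
  for M :: "'a measure" and n :: nat and C :: "nat \<Rightarrow> 'a \<Rightarrow> nat" +
  assumes n_pos: "n > 0"
    and indep: "indep_vars (\<lambda>_. count_space UNIV) C UNIV"
    and uniform: "\<And>i j. j < n \<Longrightarrow> prob {\<omega> \<in> space M. C i \<omega> = j} = 1 / real n"

definition copies :: "(nat \<Rightarrow> nat) \<Rightarrow> nat \<Rightarrow> nat \<Rightarrow> nat" where
  "copies c t j = card {i. i < t \<and> c i = j}"

text \<open>
  \<open>collection_time n m c\<close> is \<open>T\<^sub>m(n)\<close> and \<open>kton_count n m k c\<close> is \<open>S\<^sub>k\<close> for the outcome in which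
  the sequence of collected types is \<open>c\<close>. On the null event that the collection is never completed,
  the infimum is \<open>0\<close>.
\<close>

definition collection_time :: "nat \<Rightarrow> nat \<Rightarrow> (nat \<Rightarrow> nat) \<Rightarrow> nat" where
  "collection_time n m c = Inf {t. \<forall>j<n. m \<le> copies c t j}"

definition kton_count :: "nat \<Rightarrow> nat \<Rightarrow> nat \<Rightarrow> (nat \<Rightarrow> nat) \<Rightarrow> nat" where
  "kton_count n m k c = card {j. j < n \<and> copies c (collection_time n m c) j = k}"

definition gumbel_cdf :: "real \<Rightarrow> real \<Rightarrow> real \<Rightarrow> real" where
  "gumbel_cdf \<mu> \<beta> x = exp (- exp (- (x - \<mu>) / \<beta>))"

definition gumbel_distributed :: "'b measure \<Rightarrow> ('b \<Rightarrow> real) \<Rightarrow> real \<Rightarrow> real \<Rightarrow> bool" where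
  "gumbel_distributed N X \<mu> \<beta> \<longleftrightarrow>
     prob_space N \<and> X \<in> borel_measurable N \<and> cdf (distr N borel X) = gumbel_cdf \<mu> \<beta>"

text \<open>
  The library's \<open>weak_conv_m\<close> is restricted to measures on the real line, hence this definition via
  bounded continuous test functions. The \<open>n\<close>-th variable may live on its own probability space.
\<close>

definition converges_in_distribution ::
    "(nat \<Rightarrow> 'a measure) \<Rightarrow> (nat \<Rightarrow> 'a \<Rightarrow> 'c::topological_space) \<Rightarrow>
     'b measure \<Rightarrow> ('b \<Rightarrow> 'c) \<Rightarrow> bool" where
  "converges_in_distribution M V N W \<longleftrightarrow>
     (\<forall>f :: 'c \<Rightarrow> real. continuous_on UNIV f \<and> bounded (range f) \<longrightarrow>
        (\<lambda>n. integral\<^sup>L (distr (M n) borel (V n)) f)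
          \<longlonglongrightarrow> integral\<^sup>L (distr N borel W) f)"

end

theory Submission
  imports Defs "HOL-Real_Asymp.Real_Asymp"
begin

text \<open>
  Write \<open>L = ln n\<close> and \<open>u\<^sub>x = L + (m - 1) ln L + x\<close>, and look at the coupons at the deterministic time
  \<open>t\<^sub>x = \<lfloor>n u\<^sub>x\<rfloor>\<close>, when a type has \<open>u\<^sub>x\<close> copies on average. The shift \<open>(m - 1) ln L\<close> is chosen such that
  \<open>n e\<^bsup>-u\<^esup> u\<^bsup>m-1\<^esup>\<close> tends to \<open>e\<^bsup>-x\<^esup>\<close>: the number of types that have fewer than \<open>m\<close> copies has mean about
  \<open>e\<^bsup>-x\<^esup> / (m - 1)!\<close>, and the probability that there is none is about \<open>exp (- e\<^bsup>-x\<^esup> / (m - 1)!)\<close>. This is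
  the Gumbel limit of the stopping time (\<open>norm_time_cdf_tendsto\<close>). By the same computation the
  number of types with exactly \<open>k\<close> copies at time \<open>t\<^sub>x\<close> has mean about \<open>e\<^bsup>-x\<^esup> L\<^bsup>k-m+1\<^esup> / k!\<close>. This mean tends
  to infinity, so that a law of large numbers applies; and since the stopping time corresponds to a
  random \<open>x\<close> whose limit is \<open>X\<close>, the normalised number of \<open>k\<close>-tons has to follow \<open>e\<^bsup>-X\<^esup>\<close>. The growth
  condition on \<open>k\<close> is what makes \<open>(u\<^sub>x / L)\<^bsup>k\<^esup>\<close> tend to \<open>1\<close>.

  Dependence between the types is removed by Poissonisation. If the time is replaced by a Poisson
  variable of mean \<open>s\<close>, the counts of the types become independent Poisson variables of mean
  \<open>s / n\<close>. It enters as the identity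
  \<open>\<Sum>\<^sub>t e\<^bsup>-s\<^esup> s\<^bsup>t\<^esup> / t! E[\<Prod>\<^sub>j h\<^sub>j (N\<^sub>j(t))] = \<Prod>\<^sub>j E[h\<^sub>j (Poisson (s / n))]\<close>
  (\<open>poissonized_expectation_prod\<close>), an identity of power series. It gives exact formulas for the
  Poisson averages of the probability that the collection is complete, and of the variance of the
  number of types with fewer than \<open>K\<close> copies. One returns to fixed times by monotonicity: the first
  quantity increases and the tail events of the second are monotone in time, while a Poisson variable
  of mean \<open>n u\<^bsub>x-d\<^esub>\<close> or \<open>n u\<^bsub>x+d\<^esub>\<close> lies on a known side of \<open>t\<^sub>x\<close>, because its standard deviation is
  of smaller order than \<open>n d\<close> (\<open>poisson_average_initial\<close>, \<open>poisson_average_final\<close>).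

  The number of types with exactly \<open>k\<close> copies is not monotone in time, so its value at the random
  stopping time is not controlled by its values on a finite grid of times. It is, however, the
  difference of the numbers of types with fewer than \<open>k + 1\<close> and with fewer than \<open>k\<close> copies, which both
  decrease in time, and the second is negligible because \<open>k = o(L)\<close>. This yields that the
  normalised number of \<open>k\<close>-tons differs from \<open>e\<^bsup>-A\<^esup>\<close>, where \<open>A\<close> is the normalised stopping
  time, by an amount that tends to \<open>0\<close> in probability (\<open>kton_count_close\<close>). The joint limit follows by
  Slutsky's argument (\<open>converges_in_distribution_graph\<close>).
\<close>

section \<open>The expectation of products of functions of the counts\<close>

lemma fps_deriv_prod:
  fixes f :: "'b \<Rightarrow> 'a::comm_ring_1 fps"
  assumes "finite A"
  shows "fps_deriv (\<Prod>j\<in>A. f j) = (\<Sum>i\<in>A. \<Prod>j\<in>A. if j = i then fps_deriv (f j) else f j)"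
  using assms
proof (induction A rule: finite_induct)
  case (insert x A)
  have neq: "(if j = x then fps_deriv (f j) else f j) = f j" if "j \<in> A" for j
    using that insert.hyps by auto
  have "(\<Sum>i\<in>A. \<Prod>j\<in>insert x A. if j = i then fps_deriv (f j) else f j)
      = (\<Sum>i\<in>A. f x * (\<Prod>j\<in>A. if j = i then fps_deriv (f j) else f j))"
    using insert.hyps by (intro sum.cong) (auto simp: prod.insert)
  then show ?case
    using insert by (simp add: sum_distrib_left neq)
qed simp

text \<open>
  The expectation of \<open>h\<close> at a Poisson variable of mean \<open>p s\<close> is \<open>e\<^bsup>-ps\<^esup>\<close> times the value of this series
  at \<open>s\<close>.
\<close>
definition weighted_exp :: "real \<Rightarrow> (nat \<Rightarrow> real) \<Rightarrow> real fps" where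
  "weighted_exp p h = Abs_fps (\<lambda>a. h a * p ^ a / fact a)"

text \<open>
  Differentiating shifts the argument of \<open>h\<close>, just as one more copy of a type does. This is the reason
  for the product formula \<open>expectation_prod_copies\<close> below.
\<close>
lemma fps_deriv_weighted_exp:
  "fps_deriv (weighted_exp p h) = fps_const p * weighted_exp p (\<lambda>a. h (Suc a))"
proof (rule fps_ext)
  fix a
  show "fps_nth (fps_deriv (weighted_exp p h)) a
      = fps_nth (fps_const p * weighted_exp p (\<lambda>a. h (Suc a))) a"
    unfolding weighted_exp_def fps_deriv_nth fps_mult_left_const_nth fps_nth_Abs_fps
    by (simp add: field_simps del: of_nat_Suc)
qed

lemma copies_0 [simp]: "copies c 0 j = 0"
  by (simp add: copies_def)

lemma copies_Suc: "copies c (Suc t) j = copies c t j + (if c t = j then 1 else 0)"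
proof -
  have "{i. i < Suc t \<and> c i = j} = {i. i < t \<and> c i = j} \<union> (if c t = j then {t} else {})"
    by (auto simp: less_Suc_eq)
  then show ?thesis
    by (auto simp: copies_def card_insert_if)
qed

lemma copies_mono: "t \<le> t' \<Longrightarrow> copies c t j \<le> copies c t' j"
  unfolding copies_def by (intro card_mono) auto

lemma copies_cong: "(\<And>i. i < t \<Longrightarrow> c i = d i) \<Longrightarrow> copies c t j = copies d t j"
  unfolding copies_def by (intro arg_cong[where f=card]) auto

text \<open>
  Used both for the coupons as random variables and for the coordinates of a sequence of types.
\<close>
lemma measurable_copies_of:
  assumes "\<And>i. i < t \<Longrightarrow> X i \<in> measurable N (count_space UNIV)"
  shows "(\<lambda>\<omega>. copies (\<lambda>i. X i \<omega>) t j) \<in> measurable N (count_space UNIV)"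
  using assms
proof (induction t)
  case (Suc t)
  have [measurable]: "(\<lambda>\<omega>. copies (\<lambda>i. X i \<omega>) t j) \<in> measurable N (count_space UNIV)"
    "X t \<in> measurable N (count_space UNIV)"
    using Suc by auto
  show ?case unfolding copies_Suc by measurable
qed simp

context coupon_collector
begin

lemma measurable_C [measurable]: "C i \<in> measurable M (count_space UNIV)"
  using indep by (auto simp: indep_vars_def)

lemma measurable_copies [measurable]:
  "(\<lambda>\<omega>. copies (\<lambda>i. C i \<omega>) t j) \<in> measurable M (count_space UNIV)"
  by (intro measurable_copies_of) simp

lemma AE_C_less: "AE \<omega> in M. C i \<omega> < n"
proof -
  have "prob {\<omega> \<in> space M. C i \<omega> < n} = prob (\<Union>j<n. {\<omega> \<in> space M. C i \<omega> = j})"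
    by (intro arg_cong[where f=prob]) auto
  also have "\<dots> = (\<Sum>j<n. prob {\<omega> \<in> space M. C i \<omega> = j})"
    by (intro finite_measure_finite_Union) (auto simp: disjoint_family_on_def)
  also have "\<dots> = 1"
    using n_pos by (simp add: uniform)
  finally show ?thesis
    by (subst (asm) prob_Collect_eq_1) auto
qed

text \<open>
  By \<open>dep\<close>, the function \<open>g\<close> factors through the coupons before time \<open>t\<close>, of which the coupon at time \<open>t\<close>
  is independent.
\<close>
lemma indep_last_coupon:
  fixes g :: "(nat \<Rightarrow> nat) \<Rightarrow> real"
  assumes dep: "\<And>c d. (\<And>i. i < t \<Longrightarrow> c i = d i) \<Longrightarrow> g c = g d"
    and bdd: "\<And>c. \<bar>g c\<bar> \<le> B" 
    and meas: "g \<in> borel_measurable (PiM {..<t} (\<lambda>_. count_space UNIV))"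
    and i: "i < n"
  shows "expectation (\<lambda>\<omega>. indicator {i} (C t \<omega>) * g (\<lambda>i. C i \<omega>))
    = 1 / n * expectation (\<lambda>\<omega>. g (\<lambda>i. C i \<omega>))"
proof -
  have gr: "g (\<lambda>i. C i \<omega>) = g (restrict (\<lambda>i. C i \<omega>) {..<t})" for \<omega>
    by (rule dep) auto
  have "indep_var (PiM {t} (\<lambda>_. count_space UNIV)) (\<lambda>\<omega>. restrict (\<lambda>i. C i \<omega>) {t})
      (PiM {..<t} (\<lambda>_. count_space UNIV)) (\<lambda>\<omega>. restrict (\<lambda>i. C i \<omega>) {..<t})"
    by (rule indep_var_restrict[OF indep]) auto
  then have "indep_var borel ((\<lambda>c. indicator {i} (c t) :: real) \<circ> (\<lambda>\<omega>. restrict (\<lambda>i. C i \<omega>) {t}))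
      borel (g \<circ> (\<lambda>\<omega>. restrict (\<lambda>i. C i \<omega>) {..<t}))"
    by (rule indep_var_compose)
      (auto intro!: meas borel_measurable_indicator' measurable_component_singleton
        measurable_compose[OF measurable_component_singleton])
  then have iv: "indep_var borel (\<lambda>\<omega>. indicator {i} (C t \<omega>) :: real)
      borel (\<lambda>\<omega>. g (\<lambda>i. C i \<omega>))"
    by (simp add: comp_def gr[symmetric])
  have m2: "(\<lambda>\<omega>. g (\<lambda>i. C i \<omega>)) \<in> borel_measurable M"
    using indep_var_rv2[OF iv] by simp
  have "expectation (\<lambda>\<omega>. indicator {i} (C t \<omega>) * g (\<lambda>i. C i \<omega>))
    = expectation (\<lambda>\<omega>. indicator {i} (C t \<omega>)) * expectation (\<lambda>\<omega>. g (\<lambda>i. C i \<omega>))"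
  proof (rule indep_var_lebesgue_integral[OF iv])
    show "integrable M (\<lambda>\<omega>. indicator {i} (C t \<omega>) :: real)"
      using indep_var_rv1[OF iv] by (intro integrable_const_bound[where B=1]) auto
    show "integrable M (\<lambda>\<omega>. g (\<lambda>i. C i \<omega>))"
      by (rule integrable_const_bound[where B=B]) (auto simp: bdd m2)
  qed
  also have "expectation (\<lambda>\<omega>. indicator {i} (C t \<omega>)) = prob {\<omega> \<in> space M. C t \<omega> = i}"
  proof -
    have "expectation (\<lambda>\<omega>. indicator {i} (C t \<omega>) :: real) = expectation (indicator {\<omega> \<in> space M. C t \<omega> = i})"
      by (intro Bochner_Integration.integral_cong) (auto simp: indicator_def)
    then show ?thesis by simp
  qed
  finally show ?thesis using uniform[OF i, of t] by simp
qed

text \<open>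
  Both sides satisfy the same recursion in \<open>t\<close>. On the left, condition on the last coupon: if it has type
  \<open>i\<close>, the function \<open>h\<^sub>i\<close> is replaced by \<open>a \<mapsto> h\<^sub>i (a + 1)\<close>. On the right, \<open>(t + 1)!\<close> times the coefficient of
  order \<open>t + 1\<close> is \<open>t!\<close> times the coefficient of order \<open>t\<close> of the derivative, and the product rule turns
  that derivative into the same sum over \<open>i\<close>.
\<close>
lemma expectation_prod_copies:
  assumes "\<And>j a. 0 \<le> h j a" "\<And>j a. h j a \<le> (1::real)"
  shows "expectation (\<lambda>\<omega>. \<Prod>j<n. h j (copies (\<lambda>i. C i \<omega>) t j))
    = fact t * fps_nth (\<Prod>j<n. weighted_exp (1 / n) (h j)) t"
  using assms
proof (induction t arbitrary: h)
  case 0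
  have "fps_nth (\<Prod>j\<in>A. weighted_exp (1 / n) (h j)) 0 = (\<Prod>j\<in>A. h j 0)" if "finite A" for A
    using that by (induction A rule: finite_induct) (auto simp: weighted_exp_def)
  then show ?case
    by (simp add: prob_space)
next
  case (Suc t)
  \<comment> \<open>\<open>sh i\<close> is the family of functions left once the last coupon is known to be of type \<open>i\<close>.\<close>
  define sh where "sh i = (\<lambda>j. if j = i then (\<lambda>a. h j (Suc a)) else h j)" for i
  define g where "g i = (\<lambda>c. \<Prod>j<n. sh i j (copies c t j))" for i
  have g_bd: "\<bar>g i c\<bar> \<le> 1" and g_dep: "(\<And>i. i < t \<Longrightarrow> c i = d i) \<Longrightarrow> g i c = g i d" for i c d
  proof -
    show "\<bar>g i c\<bar> \<le> 1"
      unfolding g_def abs_prod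
      by (intro prod_le_1) (auto simp: sh_def Suc.prems)
    show "g i c = g i d" if "\<And>i. i < t \<Longrightarrow> c i = d i"
      unfolding g_def using copies_cong[of t c d, OF that] by simp
  qed
  have mcop: "(\<lambda>c. copies c t j) \<in> measurable (PiM {..<t} (\<lambda>_. count_space UNIV)) (count_space UNIV)" for j
    using measurable_copies_of[where X="\<lambda>i c. c i" and N="PiM {..<t} (\<lambda>_. count_space UNIV)" and t=t]
    by (auto intro: measurable_component_singleton)
  have gm: "g i \<in> borel_measurable (PiM {..<t} (\<lambda>_. count_space UNIV))" for i
    unfolding g_def
    by (intro borel_measurable_prod measurable_compose[OF mcop]) auto
  have gM: "(\<lambda>\<omega>. g i (\<lambda>i. C i \<omega>)) \<in> borel_measurable M" for i
    unfolding g_def by (intro borel_measurable_prod measurable_compose[OF measurable_copies]) auto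
  have step: "AE \<omega> in M. (\<Prod>j<n. h j (copies (\<lambda>i. C i \<omega>) (Suc t) j))
      = (\<Sum>i<n. indicator {i} (C t \<omega>) * g i (\<lambda>i. C i \<omega>))"
    using AE_C_less[of t]
  proof eventually_elim
    case (elim \<omega>)
    have "(\<Sum>i<n. indicator {i} (C t \<omega>) * g i (\<lambda>i. C i \<omega>)) = (\<Sum>i\<in>{C t \<omega>}. g i (\<lambda>i. C i \<omega>))"
      using elim by (intro sum.mono_neutral_cong_right) (auto simp: indicator_def)
    also have "\<dots> = (\<Prod>j<n. h j (copies (\<lambda>i. C i \<omega>) (Suc t) j))"
      by (auto simp: g_def sh_def copies_Suc intro!: prod.cong)
    finally show ?case ..
  qed
  have shE: "weighted_exp (1/n) (sh i j) = (if j = i then weighted_exp (1/n) (\<lambda>a. h j (Suc a)) else weighted_exp (1/n) (h j))" for i j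
    by (auto simp: sh_def)
  have dE: "(\<Prod>j<n. if j = i then fps_deriv (weighted_exp (1/n) (h j)) else weighted_exp (1/n) (h j))
      = fps_const (1/n) * (\<Prod>j<n. weighted_exp (1/n) (sh i j))" if "i < n" for i
  proof -
    have "(\<Prod>j<n. if j = i then fps_deriv (weighted_exp (1/n) (h j)) else weighted_exp (1/n) (h j))
      = (\<Prod>j<n. (if j = i then fps_const (1/n) else 1) * weighted_exp (1/n) (sh i j))"
      by (intro prod.cong) (auto simp: fps_deriv_weighted_exp shE)
    then show ?thesis
      using that by (simp add: prod.distrib)
  qed
  have "expectation (\<lambda>\<omega>. \<Prod>j<n. h j (copies (\<lambda>i. C i \<omega>) (Suc t) j))
      = expectation (\<lambda>\<omega>. \<Sum>i<n. indicator {i} (C t \<omega>) * g i (\<lambda>i. C i \<omega>))"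
    by (intro integral_cong_AE step borel_measurable_prod borel_measurable_sum borel_measurable_times gM
      measurable_compose[OF measurable_copies] measurable_compose[OF measurable_C]) auto
  also have "\<dots> = (\<Sum>i<n. expectation (\<lambda>\<omega>. indicator {i} (C t \<omega>) * g i (\<lambda>i. C i \<omega>)))"
    by (intro Bochner_Integration.integral_sum integrable_const_bound[where B=1] always_eventually borel_measurable_times gM measurable_compose[OF measurable_C])
      (auto simp: indicator_def g_bd)
  also have "\<dots> = (\<Sum>i<n. 1 / n * expectation (\<lambda>\<omega>. g i (\<lambda>i. C i \<omega>)))"
    by (intro sum.cong refl indep_last_coupon[where B=1] g_dep g_bd gm) auto
  also have "\<dots> = (\<Sum>i<n. 1 / n * (fact t * fps_nth (\<Prod>j<n. weighted_exp (1 / n) (sh i j)) t))"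
    unfolding g_def by (intro sum.cong arg_cong2[where f="(*)"] Suc.IH) (auto simp: sh_def Suc.prems)
  also have "\<dots> = fact t * fps_nth (fps_deriv (\<Prod>j<n. weighted_exp (1 / n) (h j))) t"
    by (simp add: fps_deriv_prod dE fps_sum_nth sum_distrib_left del: fps_deriv_nth)
  finally show ?case
    by simp
qed

end

section \<open>Poisson averages over time\<close>

definition poisson_weight :: "real \<Rightarrow> nat \<Rightarrow> real" where
  "poisson_weight s i = exp (- s) * s ^ i / fact i"

lemma poisson_weight_nonneg: "s \<ge> 0 \<Longrightarrow> poisson_weight s i \<ge> 0"
  by (simp add: poisson_weight_def)

lemma poisson_sums: "poisson_weight s sums 1"
proof -
  have "(\<lambda>i. exp (- s) * (s ^ i /\<^sub>R fact i)) sums (exp (- s) * exp s)"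
    by (intro sums_mult exp_converges)
  then show ?thesis
    by (simp add: poisson_weight_def[abs_def] exp_minus divide_inverse mult_ac)
qed

lemma poisson_weight_Suc: "poisson_weight s (Suc i) * real (Suc i) = s * poisson_weight s i"
  by (simp add: poisson_weight_def field_simps del: of_nat_Suc)

lemma poisson_mean_sums: "(\<lambda>i. poisson_weight s i * real i) sums s"
proof -
  have "(\<lambda>i. s * poisson_weight s i) sums (s * 1)"
    by (intro sums_mult poisson_sums)
  then have "(\<lambda>i. poisson_weight s (Suc i) * real (Suc i)) sums s"
    by (simp only: poisson_weight_Suc mult_1_right)
  then show ?thesis
    by (subst (asm) sums_Suc_iff) simp
qed

lemma poisson_variance_sums: "(\<lambda>i. poisson_weight s i * (real i - s)\<^sup>2) sums s"
proof -
  have "(\<lambda>i. s * (poisson_weight s i * real i)) sums (s * s)"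
    by (intro sums_mult poisson_mean_sums)
  moreover have "s * (poisson_weight s i * real i) = poisson_weight s (Suc i) * (real (Suc i) * (real (Suc i) - 1))" for i
    using poisson_weight_Suc[of s i] by (simp add: mult.assoc[symmetric])
  ultimately have "(\<lambda>i. poisson_weight s (Suc i) * (real (Suc i) * (real (Suc i) - 1))) sums (s * s)"
    by simp
  then have "(\<lambda>i. poisson_weight s i * (real i * (real i - 1))) sums (s * s)"
    by (subst (asm) sums_Suc_iff) simp
  from sums_add[OF sums_add[OF this sums_mult[OF poisson_mean_sums, of "1 - 2 * s"]] sums_mult[OF poisson_sums, of "s\<^sup>2"]]
  have "(\<lambda>i. poisson_weight s i * (real i * (real i - 1)) + (1 - 2 * s) * (poisson_weight s i * real i) + s\<^sup>2 * poisson_weight s i) sums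
      (s * s + (1 - 2 * s) * s + s\<^sup>2 * 1)" .
  moreover have "s * s + (1 - 2 * s) * s + s\<^sup>2 * 1 = s"
    by (simp add: power2_eq_square algebra_simps)
  moreover have "poisson_weight s i * (real i * (real i - 1)) + (1 - 2 * s) * (poisson_weight s i * real i) + s\<^sup>2 * poisson_weight s i
      = poisson_weight s i * (real i - s)\<^sup>2" for i
    by (simp add: power2_eq_square algebra_simps)
  ultimately show ?thesis by simp
qed

definition poisson_below :: "nat \<Rightarrow> real \<Rightarrow> real" where
  "poisson_below K u = (\<Sum>a<K. poisson_weight u a)"

lemma poisson_below_nonneg: "u \<ge> 0 \<Longrightarrow> poisson_below K u \<ge> 0"
  unfolding poisson_below_def by (intro sum_nonneg poisson_weight_nonneg)

lemma poisson_below_le_1: "u \<ge> 0 \<Longrightarrow> poisson_below K u \<le> 1"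
  unfolding poisson_below_def
  using sum_le_suminf[of "poisson_weight u" "{..<K}"] poisson_sums[of u] by (auto simp: sums_iff poisson_weight_nonneg)

abbreviation poisson_cdf :: "real \<Rightarrow> nat \<Rightarrow> real" where
  "poisson_cdf s t \<equiv> poisson_below (Suc t) s"

text \<open>
  A Poisson average of nonnegative terms is at least the part that comes from the times up to \<open>t\<close>. For
  a quantity that decreases in time this bounds its value at \<open>t\<close> by its Poisson average, if \<open>s\<close> is chosen
  such that the Poisson variable is at most \<open>t\<close> with probability close to \<open>1\<close>.
\<close>
lemma poisson_average_initial:
  assumes s: "s \<ge> 0" and B: "(\<lambda>i. poisson_weight s i * b i) sums B"
    and nonneg: "\<And>i. b i \<ge> 0" and le: "\<And>i. i \<le> t \<Longrightarrow> a \<le> b i"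
  shows "a * poisson_cdf s t \<le> B"
proof -
  have "a * poisson_cdf s t \<le> (\<Sum>i<Suc t. poisson_weight s i * b i)"
    unfolding poisson_below_def sum_distrib_left
  proof (rule sum_mono)
    fix i assume "i \<in> {..<Suc t}"
    then show "a * poisson_weight s i \<le> poisson_weight s i * b i"
      using mult_right_mono[OF le[of i] poisson_weight_nonneg[OF s, of i]] by (simp add: mult.commute)
  qed
  also have "\<dots> \<le> (\<Sum>i. poisson_weight s i * b i)"
    using B by (intro sum_le_suminf) (auto simp: sums_iff poisson_weight_nonneg s nonneg)
  finally show ?thesis
    using B by (simp add: sums_iff)
qed

text \<open>
  The counterpart for quantities that increase in time, with \<open>s\<close> so large that the Poisson variable
  most likely exceeds \<open>t\<close>.
\<close>
lemma poisson_average_final: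
  assumes s: "s \<ge> 0" and B: "(\<lambda>i. poisson_weight s i * b i) sums B"
    and nonneg: "\<And>i. b i \<ge> 0" and le: "\<And>i. i > t \<Longrightarrow> a \<le> b i"
  shows "a * (1 - poisson_cdf s t) \<le> B"
proof (rule sums_le)
  have "(\<lambda>i. if i \<in> {..<Suc t} then poisson_weight s i else 0) sums poisson_cdf s t"
    unfolding poisson_below_def by (rule sums_If_finite_set) simp
  from sums_mult[OF sums_diff[OF poisson_sums[of s] this], of a]
  show "(\<lambda>i. a * (poisson_weight s i - (if i \<in> {..<Suc t} then poisson_weight s i else 0))) sums (a * (1 - poisson_cdf s t))" .
  show "a * (poisson_weight s i - (if i \<in> {..<Suc t} then poisson_weight s i else 0)) \<le> poisson_weight s i * b i" for i
    using mult_right_mono[OF le[of i] poisson_weight_nonneg[OF s, of i]] 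
    by (auto simp: mult.commute poisson_weight_nonneg s nonneg)
qed (rule B)

text \<open>
  Chebyshev's inequality, as an instance of the two preceding lemmas: before \<open>t\<close>, the squared distance
  to the mean is at least \<open>(s - t)\<^sup>2\<close>.
\<close>
lemma poisson_cdf_below: 
  assumes "s \<ge> 0" "real t \<le> s"
  shows "(s - real t)\<^sup>2 * poisson_cdf s t \<le> s"
proof (rule poisson_average_initial[OF assms(1) poisson_variance_sums])
  fix i assume "i \<le> t"
  then have "(s - real t)\<^sup>2 \<le> (s - real i)\<^sup>2"
    using assms by (intro power_mono) auto
  then show "(s - real t)\<^sup>2 \<le> (real i - s)\<^sup>2"
    by (simp add: power2_commute)
qed auto

lemma poisson_cdf_above: 
  assumes "s \<ge> 0" "s \<le> real t"
  shows "(real t - s)\<^sup>2 * (1 - poisson_cdf s t) \<le> s"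
proof (rule poisson_average_final[OF assms(1) poisson_variance_sums])
  fix i assume "i > t"
  then show "(real t - s)\<^sup>2 \<le> (real i - s)\<^sup>2"
    using assms by (intro power_mono) auto
qed auto

section \<open>Independence of the counts at a Poisson time\<close>

lemma fps_conv_radius_weighted_exp:
  assumes "\<And>a. 0 \<le> h a" "\<And>a. h a \<le> 1"
  shows "fps_conv_radius (weighted_exp p h) = \<infinity>"
  unfolding fps_conv_radius_def
proof (rule conv_radius_inftyI'')
  fix z :: real
  show "summable (\<lambda>a. fps_nth (weighted_exp p h) a * z ^ a)"
  proof (rule summable_comparison_test')
    show "summable (\<lambda>a. \<bar>p * z\<bar> ^ a /\<^sub>R fact a)"
      by (rule summable_exp_generic)
    fix a :: nat
    have "\<bar>h a\<bar> * \<bar>p * z\<bar> ^ a \<le> 1 * \<bar>p * z\<bar> ^ a"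
      using assms by (intro mult_right_mono) auto
    then show "norm (fps_nth (weighted_exp p h) a * z ^ a) \<le> \<bar>p * z\<bar> ^ a /\<^sub>R fact a"
      by (simp add: weighted_exp_def abs_mult power_abs power_mult_distrib field_simps)
  qed
qed

lemma eval_fps_prod:
  fixes f :: "'b \<Rightarrow> 'a::{banach, real_normed_field} fps"
  assumes "finite A" "\<And>j. j \<in> A \<Longrightarrow> fps_conv_radius (f j) = \<infinity>"
  shows "fps_conv_radius (\<Prod>j\<in>A. f j) = \<infinity>"
    and "eval_fps (\<Prod>j\<in>A. f j) z = (\<Prod>j\<in>A. eval_fps (f j) z)"
proof -
  have "fps_conv_radius (\<Prod>j\<in>A. f j) = \<infinity> \<and>
      eval_fps (\<Prod>j\<in>A. f j) z = (\<Prod>j\<in>A. eval_fps (f j) z)"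
    using assms
  proof (induction A rule: finite_induct)
    case (insert x A)
    then have "min (fps_conv_radius (f x)) (fps_conv_radius (\<Prod>j\<in>A. f j)) = \<infinity>"
      by simp
    then have "fps_conv_radius (f x * (\<Prod>j\<in>A. f j)) = \<infinity>"
      using fps_conv_radius_mult[of "f x" "\<Prod>j\<in>A. f j"] by simp
    then show ?case
      using insert by (simp add: eval_fps_mult)
  qed simp
  then show "fps_conv_radius (\<Prod>j\<in>A. f j) = \<infinity>"
    "eval_fps (\<Prod>j\<in>A. f j) z = (\<Prod>j\<in>A. eval_fps (f j) z)"
    by auto
qed

lemma eval_weighted_exp_1: "eval_fps (weighted_exp p (\<lambda>_. 1)) s = exp (p * s)"
  by (simp add: eval_fps_def weighted_exp_def exp_def power_mult_distrib field_simps)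

lemma eval_weighted_exp_below:
  "eval_fps (weighted_exp p (indicator {..<K})) s = exp (p * s) * poisson_below K (p * s)"
proof -
  have "(\<lambda>a. if a \<in> {..<K} then p ^ a / fact a * s ^ a else 0) sums (\<Sum>a\<in>{..<K}. p ^ a / fact a * s ^ a)"
    by (rule sums_If_finite_set) simp
  moreover have "(\<lambda>a. if a \<in> {..<K} then p ^ a / fact a * s ^ a else 0)
      = (\<lambda>a. fps_nth (weighted_exp p (indicator {..<K})) a * s ^ a)"
    by (auto simp: weighted_exp_def fun_eq_iff)
  ultimately have "eval_fps (weighted_exp p (indicator {..<K})) s = (\<Sum>a<K. p ^ a / fact a * s ^ a)"
    by (simp add: eval_fps_def sums_iff)
  then show ?thesis
    by (simp add: poisson_below_def poisson_weight_def sum_distrib_left power_mult_distrib exp_minus field_simps)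
qed

lemma eval_weighted_exp_from:
  "eval_fps (weighted_exp p (indicator {K..})) s = exp (p * s) * (1 - poisson_below K (p * s))"
proof -
  have *: "weighted_exp p (indicator {K..}) = weighted_exp p (\<lambda>_. 1) - weighted_exp p (indicator {..<K})"
    by (rule fps_ext) (auto simp: weighted_exp_def indicator_def)
  have "eval_fps (weighted_exp p (indicator {K..})) s
      = eval_fps (weighted_exp p (\<lambda>_. 1)) s - eval_fps (weighted_exp p (indicator {..<K})) s"
    unfolding * by (intro eval_fps_diff) (simp_all add: fps_conv_radius_weighted_exp)
  then show ?thesis
    by (simp add: eval_weighted_exp_1 eval_weighted_exp_below algebra_simps)
qed

context coupon_collector
begin

text \<open>
  Summing \<open>expectation_prod_copies\<close> over \<open>t\<close> with Poisson weights evaluates the product of power series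
  at \<open>s\<close>, and evaluation is multiplicative. The factor \<open>e\<^bsup>-s\<^esup>\<close> is distributed evenly among the \<open>n\<close> types.
\<close>
lemma poissonized_expectation_prod:
  assumes h: "\<And>j a. 0 \<le> h j a" "\<And>j a. h j a \<le> (1::real)"
  shows "(\<lambda>t. poisson_weight s t * expectation (\<lambda>\<omega>. \<Prod>j<n. h j (copies (\<lambda>i. C i \<omega>) t j)))
    sums (\<Prod>j<n. exp (- (s / n)) * eval_fps (weighted_exp (1 / n) (h j)) s)"
proof -
  let ?P = "\<Prod>j<n. weighted_exp (1 / n) (h j)"
  have r: "fps_conv_radius ?P = \<infinity>"
    by (intro eval_fps_prod(1) fps_conv_radius_weighted_exp h) simp
  have "(\<lambda>t. fps_nth ?P t * s ^ t) sums eval_fps ?P s"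
    by (rule sums_eval_fps) (simp add: r)
  from sums_mult[OF this, of "exp (- s)"]
  have "(\<lambda>t. exp (- s) * (fps_nth ?P t * s ^ t)) sums (exp (- s) * eval_fps ?P s)" .
  moreover have "exp (- s) * (fps_nth ?P t * s ^ t) 
      = poisson_weight s t * expectation (\<lambda>\<omega>. \<Prod>j<n. h j (copies (\<lambda>i. C i \<omega>) t j))" for t
    by (subst expectation_prod_copies) (simp_all add: h poisson_weight_def)
  moreover have "exp (- s) * eval_fps ?P s = (\<Prod>j<n. exp (- (s / n)) * eval_fps (weighted_exp (1 / n) (h j)) s)"
  proof -
    have "exp (- s) = (\<Prod>j<n. exp (- (s / n)))"
      using n_pos by (simp add: exp_of_nat_mult[symmetric])
    moreover have "eval_fps ?P s = (\<Prod>j<n. eval_fps (weighted_exp (1 / n) (h j)) s)"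
      by (intro eval_fps_prod(2) fps_conv_radius_weighted_exp h) simp
    ultimately show ?thesis
      by (simp add: prod.distrib)
  qed
  ultimately show ?thesis
    by simp
qed

lemma poissonized_prob_complete:
  "(\<lambda>t. poisson_weight s t * prob {\<omega> \<in> space M. \<forall>j<n. m \<le> copies (\<lambda>i. C i \<omega>) t j})
    sums (1 - poisson_below m (s / n)) ^ n"
proof -
  have "prob {\<omega> \<in> space M. \<forall>j<n. m \<le> copies (\<lambda>i. C i \<omega>) t j}
      = expectation (\<lambda>\<omega>. \<Prod>j<n. indicator {m..} (copies (\<lambda>i. C i \<omega>) t j))" for t
  proof -
    have "prob {\<omega> \<in> space M. \<forall>j<n. m \<le> copies (\<lambda>i. C i \<omega>) t j}
      = expectation (indicator {\<omega> \<in> space M. \<forall>j<n. m \<le> copies (\<lambda>i. C i \<omega>) t j})"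
      by simp
    also have "\<dots> = expectation (\<lambda>\<omega>. \<Prod>j<n. indicator {m..} (copies (\<lambda>i. C i \<omega>) t j))"
      by (intro Bochner_Integration.integral_cong refl) (auto simp: indicator_def prod_zero_iff intro!: prod.neutral)
    finally show ?thesis .
  qed
  moreover have "(\<lambda>t. poisson_weight s t * expectation (\<lambda>\<omega>. \<Prod>j<n. indicator {m..} (copies (\<lambda>i. C i \<omega>) t j)))
    sums (\<Prod>j<n. exp (- (s / n)) * eval_fps (weighted_exp (1 / n) (indicator {m..})) s)"
    by (rule poissonized_expectation_prod) auto
  moreover have "exp (- (s / n)) * eval_fps (weighted_exp (1 / n) (indicator {m..})) s = 1 - poisson_below m (s / n)"
    by (simp add: eval_weighted_exp_from exp_minus)
  ultimately show ?thesis
    by simp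
qed

lemma poissonized_prob_few_copies:
  assumes "S \<subseteq> {..<n}"
  shows "(\<lambda>t. poisson_weight s t * prob {\<omega> \<in> space M. \<forall>j\<in>S. copies (\<lambda>i. C i \<omega>) t j < K})
    sums poisson_below K (s / n) ^ card S"
proof -
  define h :: "nat \<Rightarrow> nat \<Rightarrow> real" where "h j = (if j \<in> S then indicator {..<K} else (\<lambda>_. 1))" for j
  have fin: "finite S" using assms finite_subset by auto
  have "prob {\<omega> \<in> space M. \<forall>j\<in>S. copies (\<lambda>i. C i \<omega>) t j < K}
      = expectation (\<lambda>\<omega>. \<Prod>j<n. h j (copies (\<lambda>i. C i \<omega>) t j))" for t
  proof -
    have "prob {\<omega> \<in> space M. \<forall>j\<in>S. copies (\<lambda>i. C i \<omega>) t j < K}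
      = expectation (indicator {\<omega> \<in> space M. \<forall>j\<in>S. copies (\<lambda>i. C i \<omega>) t j < K})"
      by simp
    also have "\<dots> = expectation (\<lambda>\<omega>. \<Prod>j<n. h j (copies (\<lambda>i. C i \<omega>) t j))"
      using assms by (intro Bochner_Integration.integral_cong refl)
        (auto simp: indicator_def prod_zero_iff h_def intro!: prod.neutral bexI)
    finally show ?thesis .
  qed
  moreover have "(\<lambda>t. poisson_weight s t * expectation (\<lambda>\<omega>. \<Prod>j<n. h j (copies (\<lambda>i. C i \<omega>) t j)))
    sums (\<Prod>j<n. exp (- (s / n)) * eval_fps (weighted_exp (1 / n) (h j)) s)"
    by (rule poissonized_expectation_prod) (auto simp: h_def)
  moreover have "(\<Prod>j<n. exp (- (s / n)) * eval_fps (weighted_exp (1 / n) (h j)) s)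
      = (\<Prod>j<n. if j \<in> S then poisson_below K (s / n) else 1)"
    by (intro prod.cong) (auto simp: h_def eval_weighted_exp_below eval_weighted_exp_1 exp_minus)
  moreover have "\<dots> = (\<Prod>j\<in>S. poisson_below K (s / n))"
    using assms by (intro prod.mono_neutral_cong_right) auto
  ultimately show ?thesis
    by simp
qed

end

section \<open>From Poisson times back to fixed times\<close>

definition few_copies_count :: "nat \<Rightarrow> nat \<Rightarrow> (nat \<Rightarrow> nat) \<Rightarrow> nat \<Rightarrow> nat" where
  "few_copies_count n K c t = card {j. j < n \<and> copies c t j < K}"

lemma few_copies_count_antimono:
  "t \<le> t' \<Longrightarrow> few_copies_count n K c t' \<le> few_copies_count n K c t"
  unfolding few_copies_count_def using copies_mono[of t t' c]
  by (intro card_mono) (auto intro: le_less_trans)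

lemma few_copies_count_eq_sum:
  "real (few_copies_count n K c t) = (\<Sum>j<n. of_bool (copies c t j < K))"
proof -
  have "{j. j < n \<and> copies c t j < K} = {..<n} \<inter> {j. copies c t j < K}"
    by auto
  then show ?thesis
    by (simp add: few_copies_count_def sum_of_bool_eq)
qed

context coupon_collector
begin

lemma measurable_few_copies_count [measurable]:
  "(\<lambda>\<omega>. few_copies_count n K (\<lambda>i. C i \<omega>) t) \<in> measurable M (count_space UNIV)"
proof -
  have "(\<lambda>\<omega>. few_copies_count n K (\<lambda>i. C i \<omega>) t) = (\<lambda>\<omega>. \<Sum>j<n. if copies (\<lambda>i. C i \<omega>) t j < K then 1 else 0)"
  proof
    fix \<omega>
    have "{j. j < n \<and> copies (\<lambda>i. C i \<omega>) t j < K} = {j\<in>{..<n}. copies (\<lambda>i. C i \<omega>) t j < K}"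
      by auto
    then show "few_copies_count n K (\<lambda>i. C i \<omega>) t = (\<Sum>j<n. if copies (\<lambda>i. C i \<omega>) t j < K then 1 else 0)"
      by (simp add: few_copies_count_def sum.If_cases Int_def)
  qed
  then show ?thesis by simp
qed

lemma few_copies_count_le: "few_copies_count n K c t \<le> n"
  unfolding few_copies_count_def using card_mono[of "{..<n}" "{j. j < n \<and> copies c t j < K}"] by auto

lemma integrable_few_copies_count:
  "integrable M (\<lambda>\<omega>. (real (few_copies_count n K (\<lambda>i. C i \<omega>) t) - \<mu>)\<^sup>2)"
proof (rule integrable_const_bound[where B = "(real n + \<bar>\<mu>\<bar>)\<^sup>2"])
  show "AE \<omega> in M. norm ((real (few_copies_count n K (\<lambda>i. C i \<omega>) t) - \<mu>)\<^sup>2) \<le> (real n + \<bar>\<mu>\<bar>)\<^sup>2"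
  proof (rule always_eventually, rule allI)
    fix \<omega>
    have "\<bar>real (few_copies_count n K (\<lambda>i. C i \<omega>) t) - \<mu>\<bar> \<le> \<bar>real n + \<bar>\<mu>\<bar>\<bar>"
      using few_copies_count_le[of K "\<lambda>i. C i \<omega>" t] by linarith
    then show "norm ((real (few_copies_count n K (\<lambda>i. C i \<omega>) t) - \<mu>)\<^sup>2) \<le> (real n + \<bar>\<mu>\<bar>)\<^sup>2"
      by (subst (asm) abs_le_square_iff) simp
  qed
qed simp

text \<open>
  At a Poisson time the count is binomial with parameters \<open>n\<close> and \<open>q\<close>. Expanding the square reduces its
  variance to the events that one or two given types have few copies.
\<close>
lemma poissonized_variance_few_copies_count:
  fixes K :: nat and s q :: real defines "q \<equiv> poisson_below K (s / real n)"
  shows "(\<lambda>t. poisson_weight s t * expectation (\<lambda>\<omega>. (real (few_copies_count n K (\<lambda>i. C i \<omega>) t) - n * q)\<^sup>2))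
    sums (n * q * (1 - q))"
proof -
  let ?Y = "\<lambda>t \<omega>. real (few_copies_count n K (\<lambda>i. C i \<omega>) t)"
  let ?p = "\<lambda>S t. prob {\<omega> \<in> space M. \<forall>j\<in>S. copies (\<lambda>i. C i \<omega>) t j < K}"
  have ind: "indicator {\<omega> \<in> space M. \<forall>j\<in>S. copies (\<lambda>i. C i \<omega>) t j < K} \<omega>
      = (\<Prod>j\<in>S. of_bool (copies (\<lambda>i. C i \<omega>) t j < K) :: real)" if "finite S" "\<omega> \<in> space M" for S t \<omega>
    using that by (auto simp: indicator_def prod_zero_iff intro!: prod.neutral)
  have int: "integrable M (indicator {\<omega> \<in> space M. \<forall>j\<in>S. copies (\<lambda>i. C i \<omega>) t j < K} :: _ \<Rightarrow> real)"
    if "finite S" for S t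
    using that by (intro integrable_real_indicator) (auto simp: emeasure_eq_measure)
  have sq: "(?Y t \<omega> - n * q)\<^sup>2 = (\<Sum>i<n. \<Sum>j<n. indicator {\<omega> \<in> space M. \<forall>l\<in>{i,j}. copies (\<lambda>i. C i \<omega>) t l < K} \<omega>)
      - 2 * n * q * (\<Sum>i<n. indicator {\<omega> \<in> space M. \<forall>l\<in>{i}. copies (\<lambda>i. C i \<omega>) t l < K} \<omega>) + (n * q)\<^sup>2"
    if "\<omega> \<in> space M" for t \<omega>
  proof -
    have 1: "(?Y t \<omega>)\<^sup>2 = (\<Sum>i<n. \<Sum>j<n. indicator {\<omega> \<in> space M. \<forall>l\<in>{i,j}. copies (\<lambda>i. C i \<omega>) t l < K} \<omega>)"
      unfolding few_copies_count_eq_sum power2_eq_square sum_product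
      using that by (intro sum.cong refl) (auto simp: indicator_def)
    have 2: "?Y t \<omega> = (\<Sum>i<n. indicator {\<omega> \<in> space M. \<forall>l\<in>{i}. copies (\<lambda>i. C i \<omega>) t l < K} \<omega>)"
      unfolding few_copies_count_eq_sum
      using that by (intro sum.cong refl) (auto simp: indicator_def)
    show ?thesis
      unfolding 1[symmetric] 2[symmetric] by (simp add: power2_eq_square algebra_simps)
  qed
  have E: "expectation (\<lambda>\<omega>. (?Y t \<omega> - n * q)\<^sup>2)
      = (\<Sum>i<n. \<Sum>j<n. ?p {i,j} t) - 2 * n * q * (\<Sum>i<n. ?p {i} t) + (n * q)\<^sup>2" for t
  proof -
    have "expectation (\<lambda>\<omega>. (?Y t \<omega> - n * q)\<^sup>2)
      = expectation (\<lambda>\<omega>. (\<Sum>i<n. \<Sum>j<n. indicator {\<omega> \<in> space M. \<forall>l\<in>{i,j}. copies (\<lambda>i. C i \<omega>) t l < K} \<omega>)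
      - 2 * n * q * (\<Sum>i<n. indicator {\<omega> \<in> space M. \<forall>l\<in>{i}. copies (\<lambda>i. C i \<omega>) t l < K} \<omega>) + (n * q)\<^sup>2)"
      by (intro Bochner_Integration.integral_cong refl sq)
    also have "\<dots> = (\<Sum>i<n. \<Sum>j<n. expectation (indicator {\<omega> \<in> space M. \<forall>l\<in>{i,j}. copies (\<lambda>i. C i \<omega>) t l < K}))
      - 2 * n * q * (\<Sum>i<n. expectation (indicator {\<omega> \<in> space M. \<forall>l\<in>{i}. copies (\<lambda>i. C i \<omega>) t l < K})) + (n * q)\<^sup>2"
    proof -
      have lin: "expectation (\<lambda>\<omega>. f \<omega> - c * g \<omega> + d) = expectation f - c * expectation g + d"
        if "integrable M f" "integrable M g" for f g :: "'a \<Rightarrow> real" and c d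
        using that by (simp add: prob_space)
      have i1: "integrable M (\<lambda>\<omega>. \<Sum>i<n. \<Sum>j<n. indicator {\<omega> \<in> space M. \<forall>l\<in>{i,j}. copies (\<lambda>i. C i \<omega>) t l < K} \<omega> :: real)"
        by (intro Bochner_Integration.integrable_sum int) simp
      have i2: "integrable M (\<lambda>\<omega>. \<Sum>i<n. indicator {\<omega> \<in> space M. \<forall>l\<in>{i}. copies (\<lambda>i. C i \<omega>) t l < K} \<omega> :: real)"
        by (intro Bochner_Integration.integrable_sum int) simp
      have s1: "expectation (\<lambda>\<omega>. \<Sum>i<n. \<Sum>j<n. indicator {\<omega> \<in> space M. \<forall>l\<in>{i,j}. copies (\<lambda>i. C i \<omega>) t l < K} \<omega>)
        = (\<Sum>i<n. \<Sum>j<n. expectation (indicator {\<omega> \<in> space M. \<forall>l\<in>{i,j}. copies (\<lambda>i. C i \<omega>) t l < K} :: _ \<Rightarrow> real))"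
      proof -
        have "integrable M (\<lambda>\<omega>. \<Sum>j<n. indicator {\<omega> \<in> space M. \<forall>l\<in>{i,j}. copies (\<lambda>i. C i \<omega>) t l < K} \<omega> :: real)" for i
          by (intro Bochner_Integration.integrable_sum int) simp
        moreover have "expectation (\<lambda>\<omega>. \<Sum>j<n. indicator {\<omega> \<in> space M. \<forall>l\<in>{i,j}. copies (\<lambda>i. C i \<omega>) t l < K} \<omega>)
          = (\<Sum>j<n. expectation (indicator {\<omega> \<in> space M. \<forall>l\<in>{i,j}. copies (\<lambda>i. C i \<omega>) t l < K} :: _ \<Rightarrow> real))" for i
          by (intro Bochner_Integration.integral_sum int) simp
        ultimately show ?thesis
          by (simp only: Bochner_Integration.integral_sum)
      qed
      have s2: "expectation (\<lambda>\<omega>. \<Sum>i<n. indicator {\<omega> \<in> space M. \<forall>l\<in>{i}. copies (\<lambda>i. C i \<omega>) t l < K} \<omega>)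
        = (\<Sum>i<n. expectation (indicator {\<omega> \<in> space M. \<forall>l\<in>{i}. copies (\<lambda>i. C i \<omega>) t l < K} :: _ \<Rightarrow> real))"
        by (intro Bochner_Integration.integral_sum int) simp
      show ?thesis
        unfolding s1[symmetric] s2[symmetric] by (rule lin[OF i1 i2])
    qed
    finally show ?thesis by simp
  qed
  have "(\<lambda>t. (\<Sum>i<n. \<Sum>j<n. poisson_weight s t * ?p {i,j} t) - 2 * n * q * (\<Sum>i<n. poisson_weight s t * ?p {i} t) + (n * q)\<^sup>2 * poisson_weight s t)
      sums ((\<Sum>i<n. \<Sum>j<n. q ^ card {i,j}) - 2 * n * q * (\<Sum>i<n. q ^ card {i}) + (n * q)\<^sup>2 * 1)"
    unfolding q_def
    by (intro sums_add sums_diff sums_mult sums_sum poisson_sums poissonized_prob_few_copies) auto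
  moreover have "(\<Sum>i<n. \<Sum>j<n. poisson_weight s t * ?p {i,j} t) - 2 * n * q * (\<Sum>i<n. poisson_weight s t * ?p {i} t) + (n * q)\<^sup>2 * poisson_weight s t
     = poisson_weight s t * expectation (\<lambda>\<omega>. (?Y t \<omega> - n * q)\<^sup>2)" for t
    unfolding E by (simp add: sum_distrib_left[symmetric] algebra_simps)
  moreover have "(\<Sum>i<n. \<Sum>j<n. q ^ card {i,j}) = n * (q + (real n - 1) * q\<^sup>2)"
  proof -
    have "(\<Sum>j<n. q ^ card {i,j}) = q + (real n - 1) * q\<^sup>2" if "i < n" for i
    proof -
      have "(\<Sum>j<n. q ^ card {i,j}) = q ^ card {i,i} + (\<Sum>j\<in>{..<n}-{i}. q ^ card {i,j})"
        using that by (intro sum.remove) auto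
      also have "(\<Sum>j\<in>{..<n}-{i}. q ^ card {i,j}) = (\<Sum>j\<in>{..<n}-{i}. q\<^sup>2)"
        by (intro sum.cong) (auto simp: power2_eq_square)
      finally show ?thesis using that by simp
    qed
    then show ?thesis by simp
  qed
  moreover have "n * (q + (real n - 1) * q\<^sup>2) - 2 * n * q * (\<Sum>i<n. q ^ card {i}) + (n * q)\<^sup>2 * 1 = n * q * (1 - q)"
    using n_pos by (simp add: of_nat_diff power2_eq_square algebra_simps)
  ultimately show ?thesis
    by simp
qed

text \<open>
  The count decreases in time, so that it is large at all times before \<open>t\<close> if it is large at \<open>t\<close>, and
  small at all later times if it is small at \<open>t\<close>. Chebyshev's inequality at the Poisson time then bounds both
  events at the fixed time \<open>t\<close>.
\<close>
lemma few_copies_count_tail: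
  fixes K :: nat and s \<mu> :: real defines "\<mu> \<equiv> real n * poisson_below K (s / real n)"
  assumes "s \<ge> 0" "d > 0"
  shows "prob {\<omega> \<in> space M. real (few_copies_count n K (\<lambda>i. C i \<omega>) t) \<ge> \<mu> + d} * poisson_cdf s t \<le> \<mu> / d\<^sup>2"
    and "prob {\<omega> \<in> space M. real (few_copies_count n K (\<lambda>i. C i \<omega>) t) \<le> \<mu> - d} * (1 - poisson_cdf s t) \<le> \<mu> / d\<^sup>2"
proof -
  let ?Y = "\<lambda>i \<omega>. real (few_copies_count n K (\<lambda>i. C i \<omega>) i)"
  define b where "b i = expectation (\<lambda>\<omega>. (?Y i \<omega> - \<mu>)\<^sup>2) / d\<^sup>2" for i
  have q: "0 \<le> poisson_below K (s / n)"
    using assms by (simp add: poisson_below_nonneg)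
  have sums: "(\<lambda>i. poisson_weight s i * b i) sums (\<mu> * (1 - poisson_below K (s / n)) / d\<^sup>2)"
    unfolding b_def \<mu>_def times_divide_eq_right
    by (intro sums_divide poissonized_variance_few_copies_count)
  have le: "\<mu> * (1 - poisson_below K (s / n)) / d\<^sup>2 \<le> \<mu> / d\<^sup>2"
    using q unfolding \<mu>_def by (intro divide_right_mono mult_left_le) auto
  have b0: "b i \<ge> 0" for i
    unfolding b_def by (intro divide_nonneg_nonneg integral_nonneg) auto
  have cheb: "prob {\<omega> \<in> space M. \<bar>?Y i \<omega> - \<mu>\<bar> \<ge> d} \<le> b i" for i
  proof -
    have "{\<omega> \<in> space M. \<bar>?Y i \<omega> - \<mu>\<bar> \<ge> d} = {\<omega> \<in> space M. d\<^sup>2 \<le> (?Y i \<omega> - \<mu>)\<^sup>2}"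
      using assms by (auto simp flip: abs_le_square_iff)
    then show ?thesis
      unfolding b_def using integral_Markov_inequality_measure[OF integrable_few_copies_count, where A="{}" and c="d\<^sup>2" and \<mu>1=\<mu>] assms
      by (auto)
  qed
  have "prob {\<omega> \<in> space M. ?Y t \<omega> \<ge> \<mu> + d} * poisson_cdf s t \<le> \<mu> * (1 - poisson_below K (s / n)) / d\<^sup>2"
  proof (rule poisson_average_initial[OF \<open>s \<ge> 0\<close> sums b0])
    fix i assume "i \<le> t"
    have "prob {\<omega> \<in> space M. ?Y t \<omega> \<ge> \<mu> + d} \<le> prob {\<omega> \<in> space M. \<bar>?Y i \<omega> - \<mu>\<bar> \<ge> d}"
    proof (rule finite_measure_mono)
      show "{\<omega> \<in> space M. ?Y t \<omega> \<ge> \<mu> + d} \<subseteq> {\<omega> \<in> space M. \<bar>?Y i \<omega> - \<mu>\<bar> \<ge> d}"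
      proof safe
        fix \<omega> assume "\<mu> + d \<le> ?Y t \<omega>"
        then show "d \<le> \<bar>?Y i \<omega> - \<mu>\<bar>"
          using few_copies_count_antimono[OF \<open>i \<le> t\<close>, of n K "\<lambda>i. C i \<omega>"] by linarith
      qed
    qed measurable
    also note cheb
    finally show "prob {\<omega> \<in> space M. ?Y t \<omega> \<ge> \<mu> + d} \<le> b i" .
  qed
  with le show "prob {\<omega> \<in> space M. ?Y t \<omega> \<ge> \<mu> + d} * poisson_cdf s t \<le> \<mu> / d\<^sup>2"
    by linarith
  have "prob {\<omega> \<in> space M. ?Y t \<omega> \<le> \<mu> - d} * (1 - poisson_cdf s t) \<le> \<mu> * (1 - poisson_below K (s / n)) / d\<^sup>2"
  proof (rule poisson_average_final[OF \<open>s \<ge> 0\<close> sums b0])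
    fix i assume "i > t"
    have "prob {\<omega> \<in> space M. ?Y t \<omega> \<le> \<mu> - d} \<le> prob {\<omega> \<in> space M. \<bar>?Y i \<omega> - \<mu>\<bar> \<ge> d}"
    proof (rule finite_measure_mono)
      show "{\<omega> \<in> space M. ?Y t \<omega> \<le> \<mu> - d} \<subseteq> {\<omega> \<in> space M. \<bar>?Y i \<omega> - \<mu>\<bar> \<ge> d}"
      proof safe
        fix \<omega> assume "?Y t \<omega> \<le> \<mu> - d"
        then show "d \<le> \<bar>?Y i \<omega> - \<mu>\<bar>"
          using few_copies_count_antimono[OF less_imp_le[OF \<open>i > t\<close>], of n K "\<lambda>i. C i \<omega>"] by linarith
      qed
    qed measurable
    also note cheb
    finally show "prob {\<omega> \<in> space M. ?Y t \<omega> \<le> \<mu> - d} \<le> b i" .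
  qed
  with le show "prob {\<omega> \<in> space M. ?Y t \<omega> \<le> \<mu> - d} * (1 - poisson_cdf s t) \<le> \<mu> / d\<^sup>2"
    by linarith
qed

text \<open>
  The probability of completion increases in time and its complement decreases, so that each of the two
  comparisons of fixed with Poisson times applies.
\<close>
lemma prob_complete_bounds:
  fixes m t :: nat and F :: real defines "F \<equiv> prob {\<omega> \<in> space M. \<forall>j<n. m \<le> copies (\<lambda>i. C i \<omega>) t j}"
  assumes "s \<ge> 0"
  shows "(1 - F) * poisson_cdf s t \<le> 1 - (1 - poisson_below m (s / n)) ^ n"
    and "F * (1 - poisson_cdf s t) \<le> (1 - poisson_below m (s / n)) ^ n"
proof -
  let ?F = "\<lambda>t. prob {\<omega> \<in> space M. \<forall>j<n. m \<le> copies (\<lambda>i. C i \<omega>) t j}"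
  have mono: "?F t \<le> ?F t'" if "t \<le> t'" for t t'
    using copies_mono[OF that] by (intro finite_measure_mono) (auto intro: order_trans)
  have "(\<lambda>i. poisson_weight s i - poisson_weight s i * ?F i) sums (1 - (1 - poisson_below m (s / n)) ^ n)"
    by (intro sums_diff poisson_sums poissonized_prob_complete)
  then have "(\<lambda>i. poisson_weight s i * (1 - ?F i)) sums (1 - (1 - poisson_below m (s / n)) ^ n)"
    by (simp add: algebra_simps)
  then show "(1 - F) * poisson_cdf s t \<le> 1 - (1 - poisson_below m (s / n)) ^ n"
    by (rule poisson_average_initial[OF \<open>s \<ge> 0\<close>]) (auto simp: F_def intro: mono)
  show "F * (1 - poisson_cdf s t) \<le> (1 - poisson_below m (s / n)) ^ n"
    by (rule poisson_average_final[OF \<open>s \<ge> 0\<close> poissonized_prob_complete])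
      (auto simp: F_def intro: mono)
qed

end

section \<open>Asymptotics in the critical window\<close>

text \<open>
  The power lies between \<open>1 + k v\<close> (Bernoulli) and \<open>e\<^bsup>kv\<^esup>\<close>.
\<close>
lemma one_plus_power_tendsto_1:
  fixes v :: "nat \<Rightarrow> real"
  assumes v: "v \<longlonglongrightarrow> 0" and kv: "(\<lambda>n. real (k n) * v n) \<longlonglongrightarrow> 0"
  shows "(\<lambda>n. (1 + v n) ^ k n) \<longlonglongrightarrow> 1"
proof (rule tendsto_sandwich)
  have ev: "\<forall>\<^sub>F n in sequentially. v n > -1"
    using order_tendstoD(1)[OF v, of "-1"] by simp
  then show "\<forall>\<^sub>F n in sequentially. 1 + real (k n) * v n \<le> (1 + v n) ^ k n"
    by eventually_elim (rule Bernoulli_inequality, simp)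
  show "\<forall>\<^sub>F n in sequentially. (1 + v n) ^ k n \<le> exp (real (k n) * v n)"
    using ev
  proof eventually_elim
    case (elim n)
    then have "(1 + v n) ^ k n \<le> exp (v n) ^ k n"
      by (intro power_mono) auto
    then show ?case by (simp add: exp_of_nat_mult)
  qed
  show "(\<lambda>n. 1 + real (k n) * v n) \<longlonglongrightarrow> 1" "(\<lambda>n. exp (real (k n) * v n)) \<longlonglongrightarrow> 1"
    using tendsto_add[OF tendsto_const kv, of 1] tendsto_exp[OF kv] by simp_all
qed

text \<open>
  The power lies between \<open>exp (- n p / (1 - p))\<close> and \<open>exp (- n p)\<close>.
\<close>
lemma one_minus_power_tendsto_exp:
  fixes p :: "nat \<Rightarrow> real"
  assumes p: "\<And>n. p n \<ge> 0" and np: "(\<lambda>n. real n * p n) \<longlonglongrightarrow> c"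
  shows "(\<lambda>n. (1 - p n) ^ n) \<longlonglongrightarrow> exp (- c)"
proof (rule tendsto_sandwich)
  have "(\<lambda>n. real n * p n * inverse (real n)) \<longlonglongrightarrow> c * 0"
    by (intro tendsto_mult np lim_inverse_n)
  moreover have "\<forall>\<^sub>F n in sequentially. real n * p n * inverse (real n) = p n"
    using eventually_gt_at_top[of 0] by eventually_elim simp
  ultimately have p0: "p \<longlonglongrightarrow> 0"
    using tendsto_cong[of "\<lambda>n. real n * p n * inverse (real n)" p] by simp
  have ev: "\<forall>\<^sub>F n in sequentially. p n < 1"
    using order_tendstoD(2)[OF p0, of 1] by simp
  then show "\<forall>\<^sub>F n in sequentially. exp (- (real n * p n / (1 - p n))) \<le> (1 - p n) ^ n"
  proof eventually_elim
    case (elim n)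
    have "1 / (1 - p n) = 1 + p n / (1 - p n)"
      using elim by (simp add: field_simps)
    also have "\<dots> \<le> exp (p n / (1 - p n))"
      by simp
    finally have "exp (- (p n / (1 - p n))) \<le> 1 - p n"
      using elim by (simp add: exp_minus field_simps)
    then have "exp (- (p n / (1 - p n))) ^ n \<le> (1 - p n) ^ n"
      by (intro power_mono) auto
    then show ?case by (simp add: exp_of_nat_mult[symmetric])
  qed
  show "\<forall>\<^sub>F n in sequentially. (1 - p n) ^ n \<le> exp (- (real n * p n))"
    using ev
  proof eventually_elim
    case (elim n)
    have "(1 - p n) ^ n \<le> exp (- p n) ^ n"
      using elim exp_ge_add_one_self[of "- p n"] by (intro power_mono) auto
    then show ?case by (simp add: exp_of_nat_mult[symmetric])
  qed
  have "(\<lambda>n. exp (- (real n * p n / (1 - p n)))) \<longlonglongrightarrow> exp (- (c / (1 - 0)))"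
    by (intro tendsto_intros np p0) simp
  then show "(\<lambda>n. exp (- (real n * p n / (1 - p n)))) \<longlonglongrightarrow> exp (- c)"
    by simp
  show "(\<lambda>n. exp (- (real n * p n))) \<longlonglongrightarrow> exp (- c)"
    by (intro tendsto_intros np)
qed

text \<open>
  For \<open>k < u\<close> this says that the last weight dominates the sum: the weights up to \<open>k\<close> grow by factors of at
  least \<open>u / k\<close>, which would give the geometric bound \<open>1 / (1 - k / u)\<close>. The product form is proved by
  induction without any division.
\<close>
lemma poisson_below_Suc_le:
  assumes "u \<ge> 0"
  shows "poisson_below (Suc k) u * (u - real k) \<le> u * poisson_weight u k"
proof (induction k)
  case 0
  then show ?case by (simp add: poisson_below_def)
next
  case (Suc k)
  have "poisson_below (Suc (Suc k)) u * (u - real (Suc k))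
      = poisson_below (Suc k) u * (u - real k) - poisson_below (Suc k) u + poisson_weight u (Suc k) * (u - real (Suc k))"
    by (simp add: poisson_below_def algebra_simps)
  also have "\<dots> \<le> u * poisson_weight u k + poisson_weight u (Suc k) * (u - real (Suc k))"
    using Suc poisson_below_nonneg[OF assms, of "Suc k"] by linarith
  also have "u * poisson_weight u k = poisson_weight u (Suc k) * real (Suc k)"
    by (rule poisson_weight_Suc[symmetric])
  finally show ?case
    by (simp add: algebra_simps)
qed

text \<open>
  The mean \<open>u\<^sub>x\<close> of the number of copies of a type for which the number of types with fewer than \<open>m\<close>
  copies stays of order one.
\<close>
definition critical_mean :: "nat \<Rightarrow> nat \<Rightarrow> real \<Rightarrow> real" where
  "critical_mean m n x = ln (real n) + (real m - 1) * ln (ln (real n)) + x"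

text \<open>
  The exponent is written \<open>k + 1 - m\<close>, so that \<open>k = m - 1\<close>, the case which governs the stopping time, is
  included.
\<close>
definition kton_scale :: "nat \<Rightarrow> nat \<Rightarrow> nat \<Rightarrow> real" where
  "kton_scale m n k = ln (real n) ^ (k + 1 - m) / fact k"

lemma critical_mean_at_top: "filterlim (\<lambda>n. critical_mean m n x) at_top sequentially"
  unfolding critical_mean_def by real_asymp

lemma exp_minus_critical_mean:
  assumes "m > 0" "ln (real n) > 0"
  shows "real n * exp (- critical_mean m n x) = exp (- x) / ln (real n) ^ (m - 1)"
proof -
  have n: "real n > 0"
    using assms by (cases "n = 0") auto
  have "exp (- critical_mean m n x) = exp (- ln (real n)) * exp (- (real (m - 1) * ln (ln (real n)))) * exp (- x)"
    using assms by (simp add: critical_mean_def of_nat_diff exp_add[symmetric])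
  also have "exp (- (real (m - 1) * ln (ln (real n)))) = 1 / ln (real n) ^ (m - 1)"
    using assms exp_of_nat_mult[of "m - 1" "ln (ln (real n))"]
    by (simp add: exp_minus divide_inverse del: of_nat_diff)
  also have "exp (- ln (real n)) = 1 / real n"
    using n by (simp add: exp_minus divide_inverse)
  finally show ?thesis
    using n by (simp add: field_simps)
qed

text \<open>
  For large \<open>n\<close> the first expression equals \<open>e\<^bsup>-x\<^esup> (u\<^sub>x / L)\<^bsup>k\<^esup>\<close>. Here \<open>u\<^sub>x / L = 1 + v\<close> with
  \<open>v = ((m - 1) ln L + x) / L\<close>, and the two growth hypotheses say exactly that \<open>k v\<close> vanishes for every \<open>x\<close>.
  The other two limits follow because the last weight dominates as \<open>k / u\<^sub>x\<close> tends to \<open>0\<close>.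
\<close>
lemma poisson_critical_asymp:
  assumes m: "m > 0" and km: "\<forall>\<^sub>F n in sequentially. m \<le> Suc (k n)"
    and kL: "(\<lambda>n. real (k n) / ln (real n)) \<longlonglongrightarrow> 0"
    and kLL: "(\<lambda>n. (real m - 1) * real (k n) * ln (ln (real n)) / ln (real n)) \<longlonglongrightarrow> 0"
  shows "(\<lambda>n. real n * poisson_weight (critical_mean m n x) (k n) / kton_scale m n (k n)) \<longlonglongrightarrow> exp (- x)"
    and "(\<lambda>n. real n * poisson_below (Suc (k n)) (critical_mean m n x) / kton_scale m n (k n)) \<longlonglongrightarrow> exp (- x)"
    and "(\<lambda>n. real n * poisson_below (k n) (critical_mean m n x) / kton_scale m n (k n)) \<longlonglongrightarrow> 0"
proof -
  have L: "\<forall>\<^sub>F n in sequentially. ln (real n) > 0"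
    by real_asymp
  define v where "v n = critical_mean m n x / ln (real n) - 1" for n
  have v0: "v \<longlonglongrightarrow> 0"
    unfolding v_def critical_mean_def by real_asymp
  have "(\<lambda>n. (real m - 1) * real (k n) * ln (ln (real n)) / ln (real n) + real (k n) / ln (real n) * x) \<longlonglongrightarrow> 0"
    using tendsto_add[OF kLL tendsto_mult[OF kL tendsto_const, of x]] by simp
  then have kv: "(\<lambda>n. real (k n) * v n) \<longlonglongrightarrow> 0"
  proof (rule Lim_transform_eventually)
    show "\<forall>\<^sub>F n in sequentially. (real m - 1) * real (k n) * ln (ln (real n)) / ln (real n) + real (k n) / ln (real n) * x = real (k n) * v n"
      using L by eventually_elim (simp add: v_def critical_mean_def field_simps)
  qed
  have "(\<lambda>n. exp (- x) * (1 + v n) ^ k n) \<longlonglongrightarrow> exp (- x)"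
    using tendsto_mult[OF tendsto_const one_plus_power_tendsto_1[OF v0 kv], of "exp (- x)"] by simp
  then show poisson_weight: "(\<lambda>n. real n * poisson_weight (critical_mean m n x) (k n) / kton_scale m n (k n)) \<longlonglongrightarrow> exp (- x)"
  proof (rule Lim_transform_eventually)
    show "\<forall>\<^sub>F n in sequentially. exp (- x) * (1 + v n) ^ k n = real n * poisson_weight (critical_mean m n x) (k n) / kton_scale m n (k n)"
      using L km
    proof eventually_elim
      case (elim n)
      let ?l = "ln (real n)"
      have "real n * poisson_weight (critical_mean m n x) (k n) / kton_scale m n (k n)
          = real n * exp (- critical_mean m n x) * critical_mean m n x ^ k n / ?l ^ (k n + 1 - m)"
        by (simp add: poisson_weight_def kton_scale_def)
      also have "\<dots> = exp (- x) * critical_mean m n x ^ k n / (?l ^ (m - 1) * ?l ^ (k n + 1 - m))"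
        using elim by (subst exp_minus_critical_mean) (simp_all add: m)
      also have "?l ^ (m - 1) * ?l ^ (k n + 1 - m) = ?l ^ k n"
        using elim m by (simp add: power_add[symmetric])
      also have "exp (- x) * critical_mean m n x ^ k n / ?l ^ k n = exp (- x) * (1 + v n) ^ k n"
        by (simp add: v_def power_divide)
      finally show ?case ..
    qed
  qed
  have cr: "\<forall>\<^sub>F n in sequentially. critical_mean m n x > 0"
    using critical_mean_at_top[of m x] by (simp add: filterlim_at_top_dense)
  define r where "r n = real (k n) / critical_mean m n x" for n
  have "(\<lambda>n. real (k n) / ln (real n) / (1 + v n)) \<longlonglongrightarrow> 0"
    using tendsto_divide[OF kL tendsto_add[OF tendsto_const v0, of 1]] by simp
  then have r0: "r \<longlonglongrightarrow> 0"
  proof (rule Lim_transform_eventually)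
    show "\<forall>\<^sub>F n in sequentially. real (k n) / ln (real n) / (1 + v n) = r n"
      using L cr by eventually_elim (simp add: v_def r_def)
  qed
  have r1: "\<forall>\<^sub>F n in sequentially. r n < 1"
    using order_tendstoD(2)[OF r0, of 1] by simp
  show below: "(\<lambda>n. real n * poisson_below (Suc (k n)) (critical_mean m n x) / kton_scale m n (k n)) \<longlonglongrightarrow> exp (- x)"
  proof (rule tendsto_sandwich)
    show "\<forall>\<^sub>F n in sequentially. real n * poisson_weight (critical_mean m n x) (k n) / kton_scale m n (k n)
        \<le> real n * poisson_below (Suc (k n)) (critical_mean m n x) / kton_scale m n (k n)"
      using L cr
    proof eventually_elim
      case (elim n)
      have "poisson_weight (critical_mean m n x) (k n) \<le> poisson_below (Suc (k n)) (critical_mean m n x)"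
        using poisson_below_nonneg[of "critical_mean m n x" "k n"] elim by (simp add: poisson_below_def)
      then show ?case
        using elim by (intro divide_right_mono mult_left_mono) (auto simp: kton_scale_def)
    qed
    show "\<forall>\<^sub>F n in sequentially. real n * poisson_below (Suc (k n)) (critical_mean m n x) / kton_scale m n (k n)
        \<le> real n * poisson_weight (critical_mean m n x) (k n) / kton_scale m n (k n) / (1 - r n)"
      using L cr r1
    proof eventually_elim
      case (elim n)
      have "poisson_below (Suc (k n)) (critical_mean m n x) * (1 - r n) \<le> poisson_weight (critical_mean m n x) (k n)"
        using poisson_below_Suc_le[of "critical_mean m n x" "k n"] elim by (simp add: r_def field_simps)
      then have "poisson_below (Suc (k n)) (critical_mean m n x) \<le> poisson_weight (critical_mean m n x) (k n) / (1 - r n)"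
        using elim by (simp add: field_simps)
      then have "real n * poisson_below (Suc (k n)) (critical_mean m n x) / kton_scale m n (k n)
          \<le> real n * (poisson_weight (critical_mean m n x) (k n) / (1 - r n)) / kton_scale m n (k n)"
        using elim by (intro divide_right_mono mult_left_mono) (auto simp: kton_scale_def)
      then show ?case by (simp add: mult.commute)
    qed
    have "(\<lambda>n. real n * poisson_weight (critical_mean m n x) (k n) / kton_scale m n (k n) / (1 - r n)) \<longlonglongrightarrow> exp (- x) / (1 - 0)"
      by (intro tendsto_intros poisson_weight r0) simp
    then show "(\<lambda>n. real n * poisson_weight (critical_mean m n x) (k n) / kton_scale m n (k n) / (1 - r n)) \<longlonglongrightarrow> exp (- x)"
      by simp
  qed (rule poisson_weight)
  have "(\<lambda>n. real n * poisson_below (Suc (k n)) (critical_mean m n x) / kton_scale m n (k n)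
      - real n * poisson_weight (critical_mean m n x) (k n) / kton_scale m n (k n)) \<longlonglongrightarrow> exp (- x) - exp (- x)"
    by (intro tendsto_diff poisson_weight below)
  then show "(\<lambda>n. real n * poisson_below (k n) (critical_mean m n x) / kton_scale m n (k n)) \<longlonglongrightarrow> 0"
    by (simp add: poisson_below_def diff_divide_distrib[symmetric] right_diff_distrib[symmetric])
qed

text \<open>
  The case \<open>k = m - 1\<close> of the previous asymptotics gives the mean number of incomplete types.
\<close>
lemma complete_prob_poissonized_tendsto:
  assumes "m > 0"
  shows "(\<lambda>n. (1 - poisson_below m (critical_mean m n x)) ^ n) \<longlonglongrightarrow> gumbel_cdf (- ln (fact (m - 1))) 1 x"
proof -
  have lim: "(\<lambda>n. real n * poisson_below (Suc (m - 1)) (critical_mean m n x) / kton_scale m n (m - 1)) \<longlonglongrightarrow> exp (- x)"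
    by (rule poisson_critical_asymp(2)) (use assms in \<open>auto, real_asymp+\<close>)
  have "(\<lambda>n. real n * poisson_below m (critical_mean m n x)) \<longlonglongrightarrow> exp (- x) / fact (m - 1)"
    using tendsto_divide[OF lim tendsto_const, of "fact (m - 1)"] assms by (simp add: kton_scale_def)
  moreover have "\<forall>\<^sub>F n in sequentially. critical_mean m n x > 0"
    using critical_mean_at_top[of m x] by (simp add: filterlim_at_top_dense)
  then have ev: "\<forall>\<^sub>F n in sequentially. max 0 (poisson_below m (critical_mean m n x)) = poisson_below m (critical_mean m n x)"
    by eventually_elim (simp add: poisson_below_nonneg max_def)
  \<comment> \<open>For small \<open>n\<close> the critical mean may be negative; the maximum with \<open>0\<close> makes the general power
    lemma applicable.\<close>
  ultimately have "(\<lambda>n. real n * max 0 (poisson_below m (critical_mean m n x))) \<longlonglongrightarrow> exp (- x) / fact (m - 1)"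
    by (subst tendsto_cong[where g="\<lambda>n. real n * poisson_below m (critical_mean m n x)"]) (auto elim: eventually_mono)
  then have "(\<lambda>n. (1 - max 0 (poisson_below m (critical_mean m n x))) ^ n) \<longlonglongrightarrow> exp (- (exp (- x) / fact (m - 1)))"
    by (intro one_minus_power_tendsto_exp) auto
  then have "(\<lambda>n. (1 - poisson_below m (critical_mean m n x)) ^ n) \<longlonglongrightarrow> exp (- (exp (- x) / fact (m - 1)))"
    by (rule Lim_transform_eventually) (use ev in \<open>auto elim: eventually_mono\<close>)
  moreover have "exp (- (x - (- ln (fact (m - 1)))) / 1) = exp (- x) / fact (m - 1)"
    by (simp add: exp_diff)
  ultimately show ?thesis
    by (simp only: gumbel_cdf_def)
qed

lemma fact_le_fact_mult_power:
  assumes "m \<le> k"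
  shows "(fact k :: real) \<le> fact m * real k ^ (k - m)"
  using assms
proof (induction k rule: dec_induct)
  case (step k)
  have "(fact (Suc k) :: real) \<le> real (Suc k) * (fact m * real k ^ (k - m))"
    using step by (simp add: mult_left_mono)
  also have "\<dots> \<le> real (Suc k) * (fact m * real (Suc k) ^ (k - m))"
    by (intro mult_left_mono power_mono) auto
  finally show ?case
    using step by (simp add: Suc_diff_le mult_ac)
qed simp

text \<open>
  The expected number of \<open>k\<close>-tons tends to infinity, as the law of large numbers requires:
  \<open>k! / L\<^bsup>k-m+1\<^esup>\<close> is at most \<open>(m! / L) (k / L)\<^bsup>k-m\<^esup>\<close>, and \<open>k \<le> L\<close> eventually.
\<close>
lemma inverse_kton_scale_tendsto_0:
  assumes km: "\<forall>\<^sub>F n in sequentially. m \<le> k n"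
    and kL: "(\<lambda>n. real (k n) / ln (real n)) \<longlonglongrightarrow> 0"
  shows "(\<lambda>n. 1 / kton_scale m n (k n)) \<longlonglongrightarrow> 0"
proof (rule tendsto_sandwich)
  have L: "\<forall>\<^sub>F n in sequentially. ln (real n) > 0"
    by real_asymp
  then show "\<forall>\<^sub>F n in sequentially. 0 \<le> 1 / kton_scale m n (k n)"
    by eventually_elim (simp add: kton_scale_def)
  have "\<forall>\<^sub>F n in sequentially. real (k n) / ln (real n) < 1"
    using order_tendstoD(2)[OF kL, of 1] by simp
  then show "\<forall>\<^sub>F n in sequentially. 1 / kton_scale m n (k n) \<le> fact m / ln (real n)"
    using L km
  proof eventually_elim
    case (elim n)
    have "1 / kton_scale m n (k n) = fact (k n) / (ln (real n) * ln (real n) ^ (k n - m))"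
      using elim by (simp add: kton_scale_def Suc_diff_le)
    also have "\<dots> \<le> fact m * real (k n) ^ (k n - m) / (ln (real n) * ln (real n) ^ (k n - m))"
      using elim by (intro divide_right_mono fact_le_fact_mult_power) auto
    also have "\<dots> = fact m / ln (real n) * (real (k n) / ln (real n)) ^ (k n - m)"
      by (simp add: power_divide)
    also have "\<dots> \<le> fact m / ln (real n) * 1"
      using elim by (intro mult_left_mono power_le_one) auto
    finally show ?case by simp
  qed
  show "(\<lambda>n. fact m / ln (real n)) \<longlonglongrightarrow> 0"
    by real_asymp
qed simp

definition critical_time :: "nat \<Rightarrow> nat \<Rightarrow> real \<Rightarrow> nat" where
  "critical_time m n x = nat \<lfloor>real n * critical_mean m n x\<rfloor>"

lemma critical_time_bounds:
  assumes "critical_mean m n x \<ge> 0"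
  shows "real (critical_time m n x) \<le> real n * critical_mean m n x" "real n * critical_mean m n x - 1 < real (critical_time m n x)"
  using assms by (auto simp: critical_time_def)

text \<open>
  A Poisson variable of mean \<open>n u\<^bsub>x-d\<^esub>\<close> is centred about \<open>n d\<close> below \<open>t\<^sub>x\<close>, and its variance is only
  \<open>O(n L)\<close>. The \<open>1\<close> subtracted from \<open>n d\<close> accounts for the rounding of \<open>t\<^sub>x\<close>.
\<close>
lemma poisson_cdf_critical_time_1:
  assumes "d > 0"
  shows "(\<lambda>n. poisson_cdf (real n * critical_mean m n (x - d)) (critical_time m n x)) \<longlonglongrightarrow> 1"
proof (rule tendsto_sandwich)
  have pos: "\<forall>\<^sub>F n in sequentially. critical_mean m n (x - d) > 0" "\<forall>\<^sub>F n in sequentially. critical_mean m n x > 0"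
    using critical_mean_at_top[of m] by (simp_all add: filterlim_at_top_dense)
  have big: "\<forall>\<^sub>F n in sequentially. real n * d - 1 > 0"
    using assms by real_asymp
  show "\<forall>\<^sub>F n in sequentially. 1 - real n * critical_mean m n (x - d) / (real n * d - 1)\<^sup>2 
      \<le> poisson_cdf (real n * critical_mean m n (x - d)) (critical_time m n x)"
    using pos big
  proof eventually_elim
    case (elim n)
    let ?s = "real n * critical_mean m n (x - d)" and ?t = "critical_time m n x"
    have gap: "real n * d - 1 \<le> real ?t - ?s"
      using critical_time_bounds(2)[of m n x] elim by (simp add: critical_mean_def algebra_simps)
    have s: "?s \<ge> 0" using elim by simp
    have "(real n * d - 1)\<^sup>2 * (1 - poisson_cdf ?s ?t) \<le> (real ?t - ?s)\<^sup>2 * (1 - poisson_cdf ?s ?t)"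
      using gap elim poisson_below_le_1[OF s, of "Suc ?t"] by (intro mult_right_mono power_mono) auto
    also have "\<dots> \<le> ?s"
      using gap elim by (intro poisson_cdf_above s) auto
    finally show ?case
      using elim by (simp add: field_simps)
  qed
  show "\<forall>\<^sub>F n in sequentially. poisson_cdf (real n * critical_mean m n (x - d)) (critical_time m n x) \<le> 1"
    using pos by eventually_elim (simp add: poisson_below_le_1)
  show "(\<lambda>n. 1 - real n * critical_mean m n (x - d) / (real n * d - 1)\<^sup>2) \<longlonglongrightarrow> 1"
    using assms unfolding critical_mean_def by real_asymp
qed simp

lemma poisson_cdf_critical_time_0:
  assumes "d > 0"
  shows "(\<lambda>n. poisson_cdf (real n * critical_mean m n (x + d)) (critical_time m n x)) \<longlonglongrightarrow> 0"
proof (rule tendsto_sandwich)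
  have pos: "\<forall>\<^sub>F n in sequentially. critical_mean m n (x + d) > 0" "\<forall>\<^sub>F n in sequentially. critical_mean m n x > 0"
    using critical_mean_at_top[of m] by (simp_all add: filterlim_at_top_dense)
  show "\<forall>\<^sub>F n in sequentially. poisson_cdf (real n * critical_mean m n (x + d)) (critical_time m n x)
      \<le> real n * critical_mean m n (x + d) / (real n * d)\<^sup>2"
    using pos eventually_gt_at_top[of 0]
  proof eventually_elim
    case (elim n)
    let ?s = "real n * critical_mean m n (x + d)" and ?t = "critical_time m n x"
    have gap: "real n * d \<le> ?s - real ?t"
      using critical_time_bounds(1)[of m n x] elim by (simp add: critical_mean_def algebra_simps)
    have s: "?s \<ge> 0" using elim by simp
    have nd: "real n * d > 0" using elim assms by simp
    have "(real n * d)\<^sup>2 * poisson_cdf ?s ?t \<le> (?s - real ?t)\<^sup>2 * poisson_cdf ?s ?t"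
      using gap nd poisson_below_nonneg[OF s, of "Suc ?t"] by (intro mult_right_mono power_mono) auto
    also have "\<dots> \<le> ?s"
      using gap nd by (intro poisson_cdf_below s) auto
    finally show ?case
      using nd elim by (subst pos_le_divide_eq) (auto simp: mult.commute)
  qed
  show "\<forall>\<^sub>F n in sequentially. 0 \<le> poisson_cdf (real n * critical_mean m n (x + d)) (critical_time m n x)"
    using pos by eventually_elim (simp add: poisson_below_nonneg)
  show "(\<lambda>n. real n * critical_mean m n (x + d) / (real n * d)\<^sup>2) \<longlonglongrightarrow> 0"
    using assms unfolding critical_mean_def by real_asymp
qed simp

section \<open>The stopping time and the number of \<open>k\<close>-tons\<close>

lemma collection_time_greaterD:
  assumes "t < collection_time n m c"
  shows "\<exists>j<n. copies c t j < m"
proof (rule ccontr)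
  assume "\<not> ?thesis"
  then have "\<forall>j<n. m \<le> copies c t j"
    by (meson not_less)
  then have "t \<in> {t. \<forall>j<n. m \<le> copies c t j}"
    by (rule CollectI)
  then have "collection_time n m c \<le> t"
    unfolding collection_time_def by (rule wellorder_Inf_le1)
  with assms show False by simp
qed

text \<open>
  If the collection is never completed, its completion time is a default value. The hypothesis about
  \<open>t'\<close> excludes this case.
\<close>
lemma collection_time_leD:
  assumes "collection_time n m c \<le> t" "\<forall>j<n. m \<le> copies c t' j"
  shows "\<forall>j<n. m \<le> copies c t j"
proof -
  have "{t. \<forall>j<n. m \<le> copies c t j} \<noteq> {}"
    using assms(2) by auto
  then have "collection_time n m c \<in> {t. \<forall>j<n. m \<le> copies c t j}"
    unfolding collection_time_def by (rule Inf_nat_def1)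
  then show ?thesis
    using copies_mono[OF assms(1), of c] by (auto intro: order_trans)
qed

lemma kton_count_eq:
  "few_copies_count n (Suc k) c (collection_time n m c)
    = kton_count n m k c + few_copies_count n k c (collection_time n m c)"
proof -
  let ?T = "collection_time n m c"
  have "{j. j < n \<and> copies c ?T j < Suc k} = {j. j < n \<and> copies c ?T j = k} \<union> {j. j < n \<and> copies c ?T j < k}"
    by auto
  then show ?thesis
    unfolding few_copies_count_def kton_count_def
    by (simp only:) (intro card_Un_disjoint; auto)
qed

text \<open>
  The decomposition \<open>kton_count_eq\<close> into two counts that decrease in time controls the count at a time
  known only up to an interval.
\<close>
lemma kton_count_bounds:
  assumes "t \<le> collection_time n m c" "collection_time n m c \<le> t'"
  shows "kton_count n m k c \<le> few_copies_count n (Suc k) c t"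
    and "few_copies_count n (Suc k) c t' \<le> kton_count n m k c + few_copies_count n k c t"
  using kton_count_eq[of n k c m] few_copies_count_antimono[OF assms(1), of n "Suc k" c]
    few_copies_count_antimono[OF assms(1), of n k c] few_copies_count_antimono[OF assms(2), of n "Suc k" c]
  by linarith+

context coupon_collector
begin

lemma measurable_collection_time [measurable]:
  "(\<lambda>\<omega>. collection_time n m (\<lambda>i. C i \<omega>)) \<in> measurable M (count_space UNIV)"
proof -
  have "(\<lambda>\<omega>. LEAST t. \<forall>j<n. m \<le> copies (\<lambda>i. C i \<omega>) t j) \<in> measurable M (count_space UNIV)"
    by measurable
  then show ?thesis
    by (simp add: collection_time_def Inf_nat_def)
qed

lemma measurable_kton_count [measurable]:
  "(\<lambda>\<omega>. kton_count n m k (\<lambda>i. C i \<omega>)) \<in> measurable M (count_space UNIV)"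
proof -
  have Y: "(\<lambda>\<omega>. few_copies_count n K (\<lambda>i. C i \<omega>) (collection_time n m (\<lambda>i. C i \<omega>)))
      \<in> measurable M (count_space UNIV)" for K
    by (rule measurable_compose_countable[OF measurable_few_copies_count measurable_collection_time])
  have "(\<lambda>\<omega>. kton_count n m k (\<lambda>i. C i \<omega>)) = (\<lambda>\<omega>.
      few_copies_count n (Suc k) (\<lambda>i. C i \<omega>) (collection_time n m (\<lambda>i. C i \<omega>))
      - few_copies_count n k (\<lambda>i. C i \<omega>) (collection_time n m (\<lambda>i. C i \<omega>)))"
    by (simp add: kton_count_eq)
  then show ?thesis
    using Y[of k] Y[of "Suc k"] by simp
qed

end

definition norm_time :: "nat \<Rightarrow> nat \<Rightarrow> (nat \<Rightarrow> nat) \<Rightarrow> real" where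
  "norm_time m n c = (real (collection_time n m c) - real n * ln (real n)
     - (real m - 1) * real n * ln (ln (real n))) / real n"

lemma norm_time_le_iff:
  assumes "n > 0" "critical_mean m n x \<ge> 0"
  shows "norm_time m n c \<le> x \<longleftrightarrow> collection_time n m c \<le> critical_time m n x"
proof -
  have "norm_time m n c \<le> x \<longleftrightarrow> real (collection_time n m c) \<le> real n * critical_mean m n x"
    using assms by (simp add: norm_time_def critical_mean_def field_simps)
  also have "\<dots> \<longleftrightarrow> collection_time n m c \<le> critical_time m n x"
    using assms unfolding critical_time_def by (subst le_nat_iff) (auto simp: le_floor_iff)
  finally show ?thesis .
qed

lemma eventually_critical_mean_pos: "\<forall>\<^sub>F n in sequentially. critical_mean m n x > 0"
  using critical_mean_at_top[of m x] by (simp add: filterlim_at_top_dense)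

lemma gumbel_cdf_isCont: "isCont (gumbel_cdf \<mu> 1) x"
  unfolding gumbel_cdf_def by (intro continuous_intros) auto

text \<open>
  The first grid point that is at least \<open>y\<close> is the right end of such an interval.
\<close>
lemma grid_interval:
  fixes g :: "nat \<Rightarrow> real"
  assumes "g 0 < y" "y \<le> g N"
  shows "\<exists>i<N. g i < y \<and> y \<le> g (Suc i)"
proof -
  define l where "l = (LEAST i. y \<le> g i)"
  have l: "y \<le> g l" "l \<le> N"
    unfolding l_def using assms(2) by (auto intro: LeastI Least_le)
  then obtain i where i: "l = Suc i"
    using assms(1) by (cases l) auto
  have "\<not> y \<le> g i"
    using i unfolding l_def by (intro not_less_Least) simp
  with l i show ?thesis
    by (intro exI[of _ i]) auto
qed

context
  fixes M :: "nat \<Rightarrow> 'a measure" and C :: "nat \<Rightarrow> nat \<Rightarrow> 'a \<Rightarrow> nat"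
  assumes cc: "\<And>n. n > 0 \<Longrightarrow> coupon_collector (M n) n (C n)"
begin

text \<open>
  Comparison with the Poisson times of means \<open>n u\<^bsub>x-d\<^esub>\<close> and \<open>n u\<^bsub>x+d\<^esub>\<close> confines the limit points to the
  interval from \<open>G (x - d)\<close> to \<open>G (x + d)\<close>, for every \<open>d > 0\<close>. Continuity of \<open>G\<close> closes the gap.
\<close>
lemma prob_complete_tendsto:
  fixes m :: nat defines "G \<equiv> gumbel_cdf (- ln (fact (m - 1))) 1"
  assumes m: "m > 0"
  shows "(\<lambda>n. measure (M n) {\<omega> \<in> space (M n). \<forall>j<n. m \<le> copies (\<lambda>i. C n i \<omega>) (critical_time m n x) j}) \<longlonglongrightarrow> G x"
    (is "?F \<longlonglongrightarrow> _")
proof -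
  have cont: "((\<lambda>d. G (x - d)) \<longlongrightarrow> G x) (at_right 0)" "((\<lambda>d. G (x + d)) \<longlongrightarrow> G x) (at_right 0)"
    by (rule isCont_tendsto_compose[where g=G];
        auto simp: G_def intro!: gumbel_cdf_isCont tendsto_eq_intros)+
  show ?thesis
  proof (rule order_tendstoI)
    fix a assume "a < G x"
    then have "\<forall>\<^sub>F d in at_right 0. a < G (x - d) \<and> 0 < (d::real)"
      by (intro eventually_conj order_tendstoD(1)[OF cont(1)] eventually_at_right_less)
    then obtain d where d: "a < G (x - d)" "d > 0"
      using eventually_happens[of _ "at_right (0::real)"] by auto
    define s where "s n = real n * critical_mean m n (x - d)" for n
    have "(\<lambda>n. 1 - (1 - (1 - poisson_below m (critical_mean m n (x - d))) ^ n) / poisson_cdf (s n) (critical_time m n x)) \<longlonglongrightarrow> 1 - (1 - G (x - d)) / 1"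
      unfolding s_def G_def
      by (intro tendsto_intros poisson_cdf_critical_time_1 complete_prob_poissonized_tendsto m d) simp
    then have "\<forall>\<^sub>F n in sequentially. a < 1 - (1 - (1 - poisson_below m (critical_mean m n (x - d))) ^ n) / poisson_cdf (s n) (critical_time m n x)"
      by (rule order_tendstoD) (use d in simp)
    moreover have "\<forall>\<^sub>F n in sequentially. 0 < poisson_cdf (s n) (critical_time m n x)"
      unfolding s_def by (rule order_tendstoD[OF poisson_cdf_critical_time_1[OF d(2)]]) simp
    ultimately show "\<forall>\<^sub>F n in sequentially. a < ?F n"
      using eventually_gt_at_top[of 0] eventually_critical_mean_pos[of m "x - d"]
    proof eventually_elim
      case (elim n)
      interpret coupon_collector "M n" n "C n" using elim by (intro cc) simp
      have "(1 - ?F n) * poisson_cdf (s n) (critical_time m n x) \<le> 1 - (1 - poisson_below m (s n / n)) ^ n"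
        by (rule prob_complete_bounds(1)) (use elim in \<open>simp add: s_def\<close>)
      then have "1 - ?F n \<le> (1 - (1 - poisson_below m (critical_mean m n (x - d))) ^ n) / poisson_cdf (s n) (critical_time m n x)"
        using elim by (simp add: s_def pos_le_divide_eq)
      then show ?case using elim by linarith
    qed
  next
    fix a assume "G x < a"
    then have "\<forall>\<^sub>F d in at_right 0. G (x + d) < a \<and> 0 < (d::real)"
      by (intro eventually_conj order_tendstoD(2)[OF cont(2)] eventually_at_right_less)
    then obtain d where d: "G (x + d) < a" "d > 0"
      using eventually_happens[of _ "at_right (0::real)"] by auto
    define s where "s n = real n * critical_mean m n (x + d)" for n
    have "(\<lambda>n. (1 - poisson_below m (critical_mean m n (x + d))) ^ n / (1 - poisson_cdf (s n) (critical_time m n x))) \<longlonglongrightarrow> G (x + d) / (1 - 0)"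
      unfolding s_def G_def
      by (intro tendsto_intros poisson_cdf_critical_time_0 complete_prob_poissonized_tendsto m d) simp
    then have "\<forall>\<^sub>F n in sequentially. (1 - poisson_below m (critical_mean m n (x + d))) ^ n / (1 - poisson_cdf (s n) (critical_time m n x)) < a"
      by (rule order_tendstoD) (use d in simp)
    moreover have "\<forall>\<^sub>F n in sequentially. poisson_cdf (s n) (critical_time m n x) < 1"
      unfolding s_def by (rule order_tendstoD[OF poisson_cdf_critical_time_0[OF d(2)]]) simp
    ultimately show "\<forall>\<^sub>F n in sequentially. ?F n < a"
      using eventually_gt_at_top[of 0] eventually_critical_mean_pos[of m "x + d"]
    proof eventually_elim
      case (elim n)
      interpret coupon_collector "M n" n "C n" using elim by (intro cc) simp
      have "?F n * (1 - poisson_cdf (s n) (critical_time m n x)) \<le> (1 - poisson_below m (s n / n)) ^ n"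
        by (rule prob_complete_bounds(2)) (use elim in \<open>simp add: s_def\<close>)
      then have "?F n \<le> (1 - poisson_below m (critical_mean m n (x + d))) ^ n / (1 - poisson_cdf (s n) (critical_time m n x))"
        using elim by (simp add: s_def pos_le_divide_eq)
      then show ?case using elim by linarith
    qed
  qed
qed

text \<open>
  The normalised time is at most \<open>x\<close> if the collection is complete at time \<open>t\<^sub>x\<close>. The converse only fails
  if the collection is never completed, which is contained in incompleteness at \<open>t\<^sub>y\<close> for every \<open>y\<close>.
\<close>
lemma norm_time_cdf_tendsto:
  fixes m :: nat defines "G \<equiv> gumbel_cdf (- ln (fact (m - 1))) 1"
  assumes m: "m > 0"
  shows "(\<lambda>n. measure (M n) {\<omega> \<in> space (M n). norm_time m n (\<lambda>i. C n i \<omega>) \<le> x}) \<longlonglongrightarrow> G x"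
    (is "?P \<longlonglongrightarrow> _")
proof -
  let ?F = "\<lambda>x n. measure (M n) {\<omega> \<in> space (M n). \<forall>j<n. m \<le> copies (\<lambda>i. C n i \<omega>) (critical_time m n x) j}"
  have F: "?F x \<longlonglongrightarrow> G x" for x
    unfolding G_def by (rule prob_complete_tendsto[OF m])
  have G1: "(G \<longlongrightarrow> 1) at_top"
    unfolding G_def gumbel_cdf_def by real_asymp
  show ?thesis
  proof (rule order_tendstoI)
    fix a assume "a < G x"
    from order_tendstoD(1)[OF F this] show "\<forall>\<^sub>F n in sequentially. a < ?P n"
      using eventually_gt_at_top[of 0] eventually_critical_mean_pos[of m x]
    proof eventually_elim
      case (elim n)
      interpret coupon_collector "M n" n "C n" using elim by (intro cc) simp
      have "?F x n \<le> ?P n"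
        using elim unfolding norm_time_le_iff[OF elim(2) less_imp_le[OF elim(3)]]
        by (intro finite_measure_mono) (auto simp: not_less[symmetric] dest: collection_time_greaterD)
      then show ?case using elim by simp
    qed
  next
    fix a assume a: "G x < a"
    \<comment> \<open>For this \<open>y\<close>, incompleteness at \<open>t\<^sub>y\<close> has small probability in the limit.\<close>
    have "\<forall>\<^sub>F y in at_top. 1 - (a - G x) / 2 < G y"
      by (rule order_tendstoD(1)[OF G1]) (use a in simp)
    then obtain y where y: "1 - (a - G x) / 2 < G y"
      using eventually_happens[of _ "at_top :: real filter"] by auto
    have "(\<lambda>n. ?F x n + (1 - ?F y n)) \<longlonglongrightarrow> G x + (1 - G y)"
      by (intro tendsto_intros F)
    moreover have "G x + (1 - G y) < a"
      using y a by (simp add: field_simps)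
    ultimately have "\<forall>\<^sub>F n in sequentially. ?F x n + (1 - ?F y n) < a"
      by (rule order_tendstoD)
    then show "\<forall>\<^sub>F n in sequentially. ?P n < a"
      using eventually_gt_at_top[of 0] eventually_critical_mean_pos[of m x]
    proof eventually_elim
      case (elim n)
      interpret coupon_collector "M n" n "C n" using elim by (intro cc) simp
      let ?E = "\<lambda>x. {\<omega> \<in> space (M n). \<forall>j<n. m \<le> copies (\<lambda>i. C n i \<omega>) (critical_time m n x) j}"
      have "?P n \<le> prob (?E x \<union> (space (M n) - ?E y))"
        using elim unfolding norm_time_le_iff[OF elim(2) less_imp_le[OF elim(3)]]
      proof (intro finite_measure_mono subsetI)
        fix \<omega> assume "\<omega> \<in> {\<omega> \<in> space (M n). collection_time n m (\<lambda>i. C n i \<omega>) \<le> critical_time m n x}"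
        then show "\<omega> \<in> ?E x \<union> (space (M n) - ?E y)"
          using collection_time_leD[of n m "\<lambda>i. C n i \<omega>" "critical_time m n x" "critical_time m n y"] by auto
      qed measurable
      also have "\<dots> \<le> prob (?E x) + prob (space (M n) - ?E y)"
        by (rule measure_Un_le) measurable
      also have "prob (space (M n) - ?E y) = 1 - prob (?E y)"
        by (rule prob_compl) measurable
      finally show ?case using elim by linarith
    qed
  qed
qed

text \<open>
  Below, this is used with \<open>K = k + 1\<close> and \<open>a = 1\<close>, and with \<open>K = k\<close> and \<open>a = 0\<close>. The means at the
  neighbouring Poisson times differ from \<open>a e\<^bsup>-x\<^esup>\<close> by less than \<open>e / 2\<close> on the scale \<open>f\<close>, so a deviation of
  at least \<open>e f / 2\<close> is left to Chebyshev's inequality. The variance is at most the mean, which is \<open>O(f)\<close> and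
  hence of smaller order than \<open>f\<^sup>2\<close>.
\<close>
lemma few_copies_count_concentrated:
  fixes f :: "nat \<Rightarrow> real"
  assumes mean: "\<And>x. (\<lambda>n. real n * poisson_below (K n) (critical_mean m n x) / f n) \<longlonglongrightarrow> a * exp (- x)"
    and f: "(\<lambda>n. 1 / f n) \<longlonglongrightarrow> 0" and fpos: "\<forall>\<^sub>F n in sequentially. f n > 0"
    and e: "e > 0"
  shows "(\<lambda>n. measure (M n) {\<omega> \<in> space (M n).
      \<bar>real (few_copies_count n (K n) (\<lambda>i. C n i \<omega>) (critical_time m n x)) / f n - a * exp (- x)\<bar> \<ge> e}) \<longlonglongrightarrow> 0"
    (is "?P \<longlonglongrightarrow> 0")
proof -
  let ?Y = "\<lambda>n \<omega>. real (few_copies_count n (K n) (\<lambda>i. C n i \<omega>) (critical_time m n x))"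
  let ?m = "\<lambda>x n. real n * poisson_below (K n) (critical_mean m n x)"
  have lim: "((\<lambda>d. a * exp (- (x - d))) \<longlongrightarrow> a * exp (- x)) (at_right 0)"
    "((\<lambda>d. a * exp (- (x + d))) \<longlongrightarrow> a * exp (- x)) (at_right 0)"
    by (auto intro!: tendsto_eq_intros)
  have "\<forall>\<^sub>F d in at_right 0. a * exp (- (x - d)) < a * exp (- x) + e / 2
      \<and> a * exp (- x) - e / 2 < a * exp (- (x + d)) \<and> 0 < (d::real)"
    by (intro eventually_conj eventually_at_right_less order_tendstoD(1)[OF lim(2)] order_tendstoD(2)[OF lim(1)])
      (use e in auto)
  then obtain d where d: "a * exp (- (x - d)) < a * exp (- x) + e / 2"
      "a * exp (- x) - e / 2 < a * exp (- (x + d))" "d > 0"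
    using eventually_happens[of _ "at_right (0::real)"] by auto
  define p1 where "p1 n = poisson_cdf (real n * critical_mean m n (x - d)) (critical_time m n x)" for n
  define p2 where "p2 n = 1 - poisson_cdf (real n * critical_mean m n (x + d)) (critical_time m n x)" for n
  have p: "p1 \<longlonglongrightarrow> 1" "p2 \<longlonglongrightarrow> 1 - 0"
    unfolding p1_def p2_def by (intro tendsto_intros poisson_cdf_critical_time_1 poisson_cdf_critical_time_0 d)+
  define b where "b n = ?m (x - d) n / f n * (1 / f n) * (4 / e\<^sup>2) / p1 n
      + ?m (x + d) n / f n * (1 / f n) * (4 / e\<^sup>2) / p2 n" for n
  show ?thesis
  proof (rule tendsto_sandwich)
    show "\<forall>\<^sub>F n in sequentially. 0 \<le> ?P n" by simp
    have "b \<longlonglongrightarrow> a * exp (- (x - d)) * 0 * (4 / e\<^sup>2) / 1 + a * exp (- (x + d)) * 0 * (4 / e\<^sup>2) / (1 - 0)"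
      unfolding b_def by (intro tendsto_intros mean f p) simp_all
    then show "b \<longlonglongrightarrow> 0" by simp
    have "\<forall>\<^sub>F n in sequentially. ?m (x - d) n / f n < a * exp (- x) + e / 2"
      "\<forall>\<^sub>F n in sequentially. a * exp (- x) - e / 2 < ?m (x + d) n / f n"
      "\<forall>\<^sub>F n in sequentially. 0 < p1 n" "\<forall>\<^sub>F n in sequentially. 0 < p2 n"
      using order_tendstoD(2)[OF mean d(1)] order_tendstoD(1)[OF mean d(2)]
        order_tendstoD(1)[OF p(1), of 0] order_tendstoD(1)[OF p(2), of 0] by simp_all
    then show "\<forall>\<^sub>F n in sequentially. ?P n \<le> b n"
      using fpos eventually_critical_mean_pos[of m "x - d"] eventually_critical_mean_pos[of m "x + d"] eventually_gt_at_top[of 0]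
    proof eventually_elim
      case (elim n)
      interpret coupon_collector "M n" n "C n" using elim by (intro cc) simp
      let ?U = "{\<omega> \<in> space (M n). ?m (x - d) n + f n * e / 2 \<le> ?Y n \<omega>}"
      let ?D = "{\<omega> \<in> space (M n). ?Y n \<omega> \<le> ?m (x + d) n - f n * e / 2}"
      have eq: "c * (1 / f n) * (4 / e\<^sup>2) = c * f n / (f n * e / 2)\<^sup>2" for c
        using elim e by (simp add: field_simps power2_eq_square)
      have "?P n \<le> prob (?U \<union> ?D)"
      proof (intro finite_measure_mono subsetI)
        fix \<omega> assume \<omega>: "\<omega> \<in> {\<omega> \<in> space (M n). \<bar>?Y n \<omega> / f n - a * exp (- x)\<bar> \<ge> e}"
        then consider "?Y n \<omega> / f n \<ge> a * exp (- x) + e" | "?Y n \<omega> / f n \<le> a * exp (- x) - e"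
          by (auto simp: abs_if split: if_splits)
        then show "\<omega> \<in> ?U \<union> ?D"
        proof cases
          case 1
          then have "?m (x - d) n / f n + e / 2 \<le> ?Y n \<omega> / f n" using elim by linarith
          then have "(?m (x - d) n / f n + e / 2) * f n \<le> ?Y n \<omega> / f n * f n"
            using elim by (intro mult_right_mono) auto
          then have "\<omega> \<in> ?U" using elim \<omega> by (simp add: distrib_right distrib_left mult.commute)
          then show ?thesis by simp
        next
          case 2
          then have "?Y n \<omega> / f n \<le> ?m (x + d) n / f n - e / 2" using elim by linarith
          then have "?Y n \<omega> / f n * f n \<le> (?m (x + d) n / f n - e / 2) * f n"
            using elim by (intro mult_right_mono) auto
          then have "\<omega> \<in> ?D" using elim \<omega> by (simp add: left_diff_distrib right_diff_distrib mult.commute)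
          then show ?thesis by simp
        qed
      qed measurable
      also have "\<dots> \<le> prob ?U + prob ?D"
        by (rule measure_Un_le) measurable
      also have "prob ?U \<le> ?m (x - d) n / (f n * e / 2)\<^sup>2 / p1 n"
        using few_copies_count_tail(1)[of "real n * critical_mean m n (x - d)" "f n * e / 2" "K n" "critical_time m n x"] elim e
        by (simp add: p1_def pos_le_divide_eq mult_ac)
      also have "prob ?D \<le> ?m (x + d) n / (f n * e / 2)\<^sup>2 / p2 n"
        using few_copies_count_tail(2)[of "real n * critical_mean m n (x + d)" "f n * e / 2" "K n" "critical_time m n x"] elim e
        by (simp add: p2_def pos_le_divide_eq mult_ac)
      finally show ?case
        using elim unfolding b_def eq by simp
    qed
  qed simp
qed

text \<open>
  Cover a large interval \<open>(-R, R]\<close> for the normalised time by a grid so fine that \<open>e\<^bsup>-x\<^esup>\<close> varies by at most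
  \<open>d / 4\<close> between neighbours. Outside an event of small probability the normalised time lies in the interval,
  and at all grid points both monotone counts are within \<open>d / 4\<close> of their limits; the bounds
  \<open>kton_count_bounds\<close> then determine the count up to \<open>3 d / 4\<close>.
\<close>
lemma kton_count_close:
  fixes k :: "nat \<Rightarrow> nat"
  assumes m: "m > 0" and km: "\<forall>\<^sub>F n in sequentially. m \<le> k n"
    and kL: "(\<lambda>n. real (k n) / ln (real n)) \<longlonglongrightarrow> 0"
    and kLL: "(\<lambda>n. (real m - 1) * real (k n) * ln (ln (real n)) / ln (real n)) \<longlonglongrightarrow> 0"
    and d: "d > 0"
  shows "(\<lambda>n. measure (M n) {\<omega> \<in> space (M n).
    \<bar>real (kton_count n m (k n) (\<lambda>i. C n i \<omega>)) / kton_scale m n (k n)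
      - exp (- norm_time m n (\<lambda>i. C n i \<omega>))\<bar> \<ge> d}) \<longlonglongrightarrow> 0"
    (is "?P \<longlonglongrightarrow> 0")
proof (rule order_tendstoI)
  fix e :: real assume e: "0 < e"
  define G where "G = gumbel_cdf (- ln (fact (m - 1))) 1"
  let ?f = "\<lambda>n. kton_scale m n (k n)"
  let ?A = "\<lambda>n \<omega>. norm_time m n (\<lambda>i. C n i \<omega>)"
  let ?B = "\<lambda>n \<omega>. real (kton_count n m (k n) (\<lambda>i. C n i \<omega>)) / ?f n"
  let ?Y = "\<lambda>K x n \<omega>. real (few_copies_count n K (\<lambda>i. C n i \<omega>) (critical_time m n x))"
  have km': "\<forall>\<^sub>F n in sequentially. m \<le> Suc (k n)"
    using km by eventually_elim simp
  have fpos: "\<forall>\<^sub>F n in sequentially. ?f n > 0"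
  proof -
    have "\<forall>\<^sub>F n in sequentially. ln (real n) > 0" by real_asymp
    then show ?thesis by eventually_elim (simp add: kton_scale_def)
  qed
  note finv = inverse_kton_scale_tendsto_0[OF km kL]
  have "((\<lambda>R. G (- R) + (1 - G R)) \<longlongrightarrow> 0) at_top"
    unfolding G_def gumbel_cdf_def by real_asymp
  then have "\<forall>\<^sub>F R in at_top. G (- R) + (1 - G R) < e \<and> R > 0"
    by (intro eventually_conj order_tendstoD(2)[OF _ e] eventually_gt_at_top)
  then obtain R where R: "G (- R) + (1 - G R) < e" "R > 0"
    using eventually_happens[of _ "at_top :: real filter"] by auto
  \<comment> \<open>Neighbours have distance \<open>2 R / N\<close>, and \<open>e\<^bsup>-x\<^esup>\<close> has slope at most \<open>e\<^bsup>R\<^esup>\<close> on the interval.\<close>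
  obtain N :: nat where N: "real N > exp R * (2 * R) * 4 / d"
    using reals_Archimedean2 by blast
  have N0: "real N > 0"
    using N R d by (smt (verit) divide_nonneg_pos exp_gt_zero mult_nonneg_nonneg)
  define g where "g i = - R + 2 * R / N * real i" for i
  have gap: "exp (- g i) \<le> exp (- g (Suc i)) + d / 4" for i
  proof -
    have "exp (- g i) * (1 - 2 * R / N) \<le> exp (- g i) * exp (- (2 * R / N))"
      using exp_ge_add_one_self[of "- (2 * R / N)"] by (intro mult_left_mono) auto
    also have "\<dots> = exp (- g (Suc i))"
      by (simp add: g_def exp_add[symmetric] algebra_simps add_divide_distrib)
    finally have "exp (- g i) \<le> exp (- g (Suc i)) + exp (- g i) * (2 * R / N)"
      by (simp add: algebra_simps)
    also have "exp (- g i) * (2 * R / N) \<le> exp R * (2 * R / N)"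
      using R N0 by (intro mult_right_mono) (auto simp: g_def)
    also have "\<dots> \<le> d / 4"
      using N N0 d by (simp add: field_simps)
    finally show ?thesis by simp
  qed
  define c1 where "c1 i n = measure (M n) {\<omega> \<in> space (M n). \<bar>?Y (Suc (k n)) (g i) n \<omega> / ?f n - 1 * exp (- g i)\<bar> \<ge> d / 4}" for i n
  define c0 where "c0 i n = measure (M n) {\<omega> \<in> space (M n). \<bar>?Y (k n) (g i) n \<omega> / ?f n - 0 * exp (- g i)\<bar> \<ge> d / 4}" for i n
  have c1: "c1 i \<longlonglongrightarrow> 0" for i
    unfolding c1_def
    by (rule few_copies_count_concentrated)
      (use poisson_critical_asymp(2)[OF m km' kL kLL] fpos finv d in auto)
  have c0: "c0 i \<longlonglongrightarrow> 0" for i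
    unfolding c0_def
    by (rule few_copies_count_concentrated)
      (use poisson_critical_asymp(3)[OF m km' kL kLL] fpos finv d in auto)
  define b where "b n = measure (M n) {\<omega> \<in> space (M n). ?A n \<omega> \<le> - R}
      + (1 - measure (M n) {\<omega> \<in> space (M n). ?A n \<omega> \<le> R}) + (\<Sum>i\<le>N. c1 i n) + (\<Sum>i\<le>N. c0 i n)" for n
  have "b \<longlonglongrightarrow> G (- R) + (1 - G R) + (\<Sum>i\<le>N. 0) + (\<Sum>i\<le>N. 0)"
    unfolding b_def G_def
    by (intro tendsto_intros norm_time_cdf_tendsto[OF m] c0 c1)
  then have "b \<longlonglongrightarrow> G (- R) + (1 - G R)" by simp
  from order_tendstoD(2)[OF this R(1)]
  show "\<forall>\<^sub>F n in sequentially. ?P n < e"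
    using fpos eventually_gt_at_top[of 0] eventually_critical_mean_pos[of m "- R"]
  proof eventually_elim
    case (elim n)
    interpret coupon_collector "M n" n "C n" using elim by (intro cc) simp
    have mA [measurable]: "?A n \<in> borel_measurable (M n)"
      unfolding norm_time_def by measurable
    let ?L = "{\<omega> \<in> space (M n). ?A n \<omega> \<le> - R}" and ?H = "{\<omega> \<in> space (M n). ?A n \<omega> \<le> R}"
    let ?E1 = "\<lambda>i. {\<omega> \<in> space (M n). \<bar>?Y (Suc (k n)) (g i) n \<omega> / ?f n - 1 * exp (- g i)\<bar> \<ge> d / 4}"
    let ?E0 = "\<lambda>i. {\<omega> \<in> space (M n). \<bar>?Y (k n) (g i) n \<omega> / ?f n - 0 * exp (- g i)\<bar> \<ge> d / 4}"
    let ?U1 = "\<Union>i\<in>{..N}. ?E1 i" and ?U0 = "\<Union>i\<in>{..N}. ?E0 i"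
    have "?P n \<le> prob (((?L \<union> (space (M n) - ?H)) \<union> ?U1) \<union> ?U0)"
    proof (intro finite_measure_mono subsetI)
      fix \<omega> assume \<omega>: "\<omega> \<in> {\<omega> \<in> space (M n). \<bar>?B n \<omega> - exp (- ?A n \<omega>)\<bar> \<ge> d}"
      show "\<omega> \<in> ((?L \<union> (space (M n) - ?H)) \<union> ?U1) \<union> ?U0"
      proof (rule ccontr)
        assume nin: "\<not> ?thesis"
        have c1: "\<bar>?Y (Suc (k n)) (g i) n \<omega> / ?f n - exp (- g i)\<bar> < d / 4" if "i \<le> N" for i
          using nin that \<omega> by (auto simp: not_le)
        have c0: "\<bar>?Y (k n) (g i) n \<omega> / ?f n\<bar> < d / 4" if "i \<le> N" for i
          using nin that \<omega> by (auto simp: not_le)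
        have "- R < ?A n \<omega>" "?A n \<omega> \<le> R"
          using nin \<omega> by auto
        then obtain i where i: "i < N" "g i < ?A n \<omega>" "?A n \<omega> \<le> g (Suc i)"
          using grid_interval[of g "?A n \<omega>" N] N0 by (auto simp: g_def)
        have g_ge: "g j \<ge> - R" for j
          using R N0 by (simp add: g_def)
        have cr: "critical_mean m n (g j) \<ge> 0" for j
          using elim(4) g_ge[of j] unfolding critical_mean_def by linarith
        let ?T = "collection_time n m (\<lambda>i. C n i \<omega>)"
        have T: "critical_time m n (g i) \<le> ?T" "?T \<le> critical_time m n (g (Suc i))"
          using i norm_time_le_iff[OF elim(3) cr, of "\<lambda>i. C n i \<omega>"] by (auto simp: not_le[symmetric])
        have "?B n \<omega> \<le> ?Y (Suc (k n)) (g i) n \<omega> / ?f n"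
          using kton_count_bounds(1)[OF T, of "k n"] elim by (intro divide_right_mono) auto
        moreover have "?Y (Suc (k n)) (g (Suc i)) n \<omega> / ?f n \<le> ?B n \<omega> + ?Y (k n) (g i) n \<omega> / ?f n"
          unfolding add_divide_distrib[symmetric]
          using kton_count_bounds(2)[OF T, of "k n"] elim by (intro divide_right_mono) linarith+
        moreover have "exp (- ?A n \<omega>) \<le> exp (- g i)" "exp (- g (Suc i)) \<le> exp (- ?A n \<omega>)"
          using i by auto
        ultimately have "\<bar>?B n \<omega> - exp (- ?A n \<omega>)\<bar> < d"
          using c1[of i] c1[of "Suc i"] c0[of i] gap[of i] i(1) d by linarith
        with \<omega> show False by simp
      qed
    qed measurable
    also have "\<dots> \<le> prob ((?L \<union> (space (M n) - ?H)) \<union> ?U1) + prob ?U0"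
      by (rule measure_Un_le) measurable
    also have "prob ((?L \<union> (space (M n) - ?H)) \<union> ?U1) \<le> prob (?L \<union> (space (M n) - ?H)) + prob ?U1"
      by (rule measure_Un_le) measurable
    also have "prob (?L \<union> (space (M n) - ?H)) \<le> prob ?L + prob (space (M n) - ?H)"
      by (rule measure_Un_le) measurable
    also have "prob (space (M n) - ?H) = 1 - prob ?H"
      by (rule prob_compl) measurable
    also have "prob ?U1 \<le> (\<Sum>i\<le>N. c1 i n)"
      unfolding c1_def by (rule finite_measure_subadditive_finite) auto
    also have "prob ?U0 \<le> (\<Sum>i\<le>N. c0 i n)"
      unfolding c0_def by (rule finite_measure_subadditive_finite) auto
    finally show ?case
      using elim by (simp add: b_def)
  qed
next
  fix e :: real assume "e < 0"
  then show "\<forall>\<^sub>F n in sequentially. e < ?P n"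
    by (intro always_eventually allI less_le_trans[OF _ measure_nonneg])
qed

end

section \<open>Convergence of the joint distribution\<close>

text \<open>
  Slutsky's argument: \<open>(A, g A)\<close> converges in distribution because \<open>A\<close> does, and replacing \<open>g A\<close> by \<open>B\<close>
  changes the integral of a test function by little, because the test function is uniformly continuous
  on a compact neighbourhood of the graph of \<open>g\<close> over \<open>[-R, R]\<close>. The variables are only controlled for
  \<open>n > 0\<close>, hence the passage to \<open>Suc n\<close> when the weak convergence on the line is used.
\<close>
lemma converges_in_distribution_graph:
  fixes A B :: "nat \<Rightarrow> 'a \<Rightarrow> real" and X :: "'b \<Rightarrow> real" and g :: "real \<Rightarrow> real"
  assumes M: "\<And>n. n > 0 \<Longrightarrow> prob_space (M n)"
    and A: "\<And>n. n > 0 \<Longrightarrow> A n \<in> borel_measurable (M n)"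
    and B: "\<And>n. n > 0 \<Longrightarrow> B n \<in> borel_measurable (M n)"
    and N: "prob_space N" and X: "X \<in> borel_measurable N"
    and conv: "\<And>x. (\<lambda>n. measure (M n) {\<omega> \<in> space (M n). A n \<omega> \<le> x}) \<longlonglongrightarrow> cdf (distr N borel X) x"
    and close: "\<And>d. d > 0 \<Longrightarrow> (\<lambda>n. measure (M n) {\<omega> \<in> space (M n). \<bar>B n \<omega> - g (A n \<omega>)\<bar> \<ge> d}) \<longlonglongrightarrow> 0"
    and g: "continuous_on UNIV g"
  shows "converges_in_distribution M (\<lambda>n \<omega>. (A n \<omega>, B n \<omega>)) N (\<lambda>\<omega>. (X \<omega>, g (X \<omega>)))"
  unfolding converges_in_distribution_def
proof (intro allI impI, elim conjE)
  fix f :: "real \<times> real \<Rightarrow> real"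
  assume f: "continuous_on UNIV f" and "bounded (range f)"
  then obtain K where K: "\<And>z. \<bar>f z\<bar> \<le> K"
    unfolding bounded_iff by auto
  then have K0: "K \<ge> 0"
    using abs_ge_zero order_trans by blast
  interpret N: prob_space N by fact
  have XD: "real_distribution (distr N borel X)"
    using X by (intro N.real_distribution_distr)
  interpret XD: real_distribution "distr N borel X" by fact
  let ?h = "\<lambda>x. f (x, g x)"
  have h: "continuous_on UNIV ?h"
    by (rule continuous_on_compose2[OF f]) (auto intro!: continuous_intros g)
  have fm: "f \<in> borel_measurable borel" and hm: "?h \<in> borel_measurable borel" and gm: "g \<in> borel_measurable borel"
    using f h g by (auto intro: borel_measurable_continuous_onI)
  note [measurable] = hm gm
  define E where "E n = integral\<^sup>L (M n) (\<lambda>\<omega>. ?h (A n \<omega>))" for n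
  have lim1: "E \<longlonglongrightarrow> integral\<^sup>L (distr N borel X) ?h"
  proof -
    let ?D = "\<lambda>n. distr (M (Suc n)) borel (A (Suc n))"
    have D: "real_distribution (?D n)" for n
      using M[of "Suc n"] A[of "Suc n"] by (intro prob_space.real_distribution_distr) auto
    have "cdf (?D n) x = measure (M (Suc n)) {\<omega> \<in> space (M (Suc n)). A (Suc n) \<omega> \<le> x}" for n x
      using A[of "Suc n"] by (auto simp: cdf_def measure_distr intro!: arg_cong[where f="measure _"])
    then have "weak_conv_m ?D (distr N borel X)"
      using conv unfolding weak_conv_m_def weak_conv_def by (auto intro: LIMSEQ_Suc)
    then have "(\<lambda>n. integral\<^sup>L (?D n) ?h) \<longlonglongrightarrow> integral\<^sup>L (distr N borel X) ?h"
      by (rule weak_conv_imp_integral_bdd_continuous_conv[OF D XD, where B=K])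
        (use h K in \<open>auto simp: continuous_on_eq_continuous_at\<close>)
    moreover have "integral\<^sup>L (?D n) ?h = E (Suc n)" for n
      unfolding E_def using A[of "Suc n"] by (subst integral_distr) auto
    ultimately show ?thesis
      by (simp add: LIMSEQ_imp_Suc)
  qed
  define F where "F n = integral\<^sup>L (M n) (\<lambda>\<omega>. f (A n \<omega>, B n \<omega>))" for n
  have lim2: "(\<lambda>n. F n - E n) \<longlonglongrightarrow> 0"
  proof (rule LIMSEQ_I)
    fix r :: real assume r: "r > 0"
    \<comment> \<open>The difference of the integrals will be at most \<open>e + 2 K e = r - e\<close>.\<close>
    define e where "e = r / (2 * K + 2)"
    have e: "e > 0" using r K0 by (simp add: e_def)
    have "((\<lambda>R. cdf (distr N borel X) (- R) + (1 - cdf (distr N borel X) R)) \<longlongrightarrow> 0 + (1 - 1)) at_top"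
      by (intro tendsto_intros XD.cdf_lim_at_top_prob filterlim_compose[OF XD.cdf_lim_at_bot filterlim_uminus_at_bot_at_top])
    then have "\<forall>\<^sub>F R in at_top. cdf (distr N borel X) (- R) + (1 - cdf (distr N borel X) R) < e / 2"
      by (rule order_tendstoD) (use e in simp)
    then obtain R where R: "cdf (distr N borel X) (- R) + (1 - cdf (distr N borel X) R) < e / 2"
      using eventually_happens[of _ "at_top :: real filter"] by auto
    define S where "S = (\<lambda>z. (fst z, g (fst z) + snd z)) ` ({- R..R} \<times> {-1..1})"
    have "compact S"
      unfolding S_def
      by (intro compact_continuous_image compact_Times compact_Icc)
        (auto intro!: continuous_intros continuous_on_compose2[OF g])
    then have "uniformly_continuous_on S f"
      using f by (intro compact_uniformly_continuous) (auto intro: continuous_on_subset)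
    then obtain d where d: "d > 0" "\<And>z z'. z \<in> S \<Longrightarrow> z' \<in> S \<Longrightarrow> dist z' z < d \<Longrightarrow> dist (f z') (f z) < e"
      using e unfolding uniformly_continuous_on_def by metis
    \<comment> \<open>The bound \<open>1\<close> keeps \<open>B\<close> inside the compact set \<open>S\<close>.\<close>
    define d' where "d' = min d 1"
    have d': "d' > 0" "d' \<le> d" "d' \<le> 1" using d by (auto simp: d'_def)
    let ?L = "\<lambda>n. {\<omega> \<in> space (M n). A n \<omega> \<le> - R}" and ?H = "\<lambda>n. {\<omega> \<in> space (M n). A n \<omega> \<le> R}"
      and ?C = "\<lambda>n. {\<omega> \<in> space (M n). \<bar>B n \<omega> - g (A n \<omega>)\<bar> \<ge> d'}"
    define b where "b n = measure (M n) (?L n) + (1 - measure (M n) (?H n)) + measure (M n) (?C n)" for n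
    have "b \<longlonglongrightarrow> cdf (distr N borel X) (- R) + (1 - cdf (distr N borel X) R) + 0"
      unfolding b_def by (intro tendsto_intros conv close d')
    then have "\<forall>\<^sub>F n in sequentially. b n < e"
      by (rule order_tendstoD) (use R e in simp)
    then have "\<forall>\<^sub>F n in sequentially. norm (F n - E n - 0) < r"
      using eventually_gt_at_top[of 0]
    proof eventually_elim
      case (elim n)
      interpret prob_space "M n" using elim by (intro M) simp
      have [measurable]: "A n \<in> borel_measurable (M n)" "B n \<in> borel_measurable (M n)"
        using A B elim by auto
      have fAB [measurable]: "(\<lambda>\<omega>. f (A n \<omega>, B n \<omega>)) \<in> borel_measurable (M n)"
        by (rule measurable_compose[OF _ fm]) (simp add: borel_prod[symmetric])
      define U where "U = (?L n \<union> (space (M n) - ?H n)) \<union> ?C n"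
      have [measurable]: "U \<in> sets (M n)"
        unfolding U_def by measurable
      have pt: "\<bar>f (A n \<omega>, B n \<omega>) - ?h (A n \<omega>)\<bar> \<le> e + 2 * K * indicator U \<omega>" if "\<omega> \<in> space (M n)" for \<omega>
      proof (cases "\<omega> \<in> U")
        case True
        then show ?thesis
          using K[of "(A n \<omega>, B n \<omega>)"] K[of "(A n \<omega>, g (A n \<omega>))"] e by simp
      next
        case False
        then have *: "A n \<omega> \<in> {- R..R}" "\<bar>B n \<omega> - g (A n \<omega>)\<bar> < d'"
          using that by (auto simp: U_def)
        have "(A n \<omega>, B n \<omega>) \<in> S"
          unfolding S_def using * d' by (intro image_eqI[where x="(A n \<omega>, B n \<omega> - g (A n \<omega>))"]) auto
        moreover have "(A n \<omega>, g (A n \<omega>)) \<in> S"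
          unfolding S_def using * by (intro image_eqI[where x="(A n \<omega>, 0)"]) auto
        moreover have "dist (A n \<omega>, B n \<omega>) (A n \<omega>, g (A n \<omega>)) < d"
          using * d' by (simp add: dist_Pair_Pair dist_real_def)
        ultimately have "dist (f (A n \<omega>, B n \<omega>)) (?h (A n \<omega>)) < e"
          by (intro d(2))
        then show ?thesis using False by (simp add: dist_real_def)
      qed
      have i1: "integrable (M n) (\<lambda>\<omega>. f (A n \<omega>, B n \<omega>))"
        by (rule integrable_const_bound[where B=K]) (auto simp: K)
      have i2: "integrable (M n) (\<lambda>\<omega>. ?h (A n \<omega>))"
        by (rule integrable_const_bound[where B=K]) (auto simp: K)
      have i3: "integrable (M n) (\<lambda>\<omega>. e + 2 * K * indicator U \<omega>)"
        by (intro Bochner_Integration.integrable_add integrable_mult_right integrable_real_indicator)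
          (auto simp: emeasure_eq_measure)
      have "\<bar>F n - E n\<bar> = \<bar>expectation (\<lambda>\<omega>. f (A n \<omega>, B n \<omega>) - ?h (A n \<omega>))\<bar>"
        unfolding F_def E_def using i1 i2 by simp
      also have "\<dots> \<le> expectation (\<lambda>\<omega>. \<bar>f (A n \<omega>, B n \<omega>) - ?h (A n \<omega>)\<bar>)"
        by (rule integral_abs_bound)
      also have "\<dots> \<le> expectation (\<lambda>\<omega>. e + 2 * K * indicator U \<omega>)"
        using i1 i2 i3 pt by (intro integral_mono) auto
      also have "\<dots> = e + 2 * K * prob U"
        by (subst Bochner_Integration.integral_add) (auto simp: prob_space emeasure_eq_measure)
      also have "prob U \<le> b n"
      proof -
        have "prob U \<le> prob (?L n \<union> (space (M n) - ?H n)) + prob (?C n)"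
          unfolding U_def by (rule measure_Un_le) measurable
        also have "prob (?L n \<union> (space (M n) - ?H n)) \<le> prob (?L n) + prob (space (M n) - ?H n)"
          by (rule measure_Un_le) measurable
        also have "prob (space (M n) - ?H n) = 1 - prob (?H n)"
          by (rule prob_compl) measurable
        finally show ?thesis by (simp add: b_def)
      qed
      also have "e + 2 * K * b n \<le> e + 2 * K * e"
        using elim K0 by (intro add_left_mono mult_left_mono) auto
      also have "\<dots> < r"
      proof -
        have "e * (2 * K + 2) = r"
          using K0 unfolding e_def by simp
        then show ?thesis
          using e by (simp add: algebra_simps)
      qed
      finally show ?case
        using K0 by (simp add: mult_left_mono)
    qed
    then show "\<exists>no. \<forall>n\<ge>no. norm (F n - E n - 0) < r"
      by (simp add: eventually_sequentially)
  qed
  from tendsto_add[OF lim2 lim1] have F: "F \<longlonglongrightarrow> integral\<^sup>L (distr N borel X) ?h"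
    by simp
  have eq: "integral\<^sup>L (distr N borel X) ?h = integral\<^sup>L (distr N borel (\<lambda>\<omega>. (X \<omega>, g (X \<omega>)))) f"
  proof -
    have "(\<lambda>\<omega>. (X \<omega>, g (X \<omega>))) \<in> borel_measurable N"
      using X by (simp add: borel_prod[symmetric])
    then show ?thesis
      using X fm by (simp add: integral_distr)
  qed
  have ev: "\<forall>\<^sub>F n in sequentially. F n = integral\<^sup>L (distr (M n) borel (\<lambda>\<omega>. (A n \<omega>, B n \<omega>))) f"
    using eventually_gt_at_top[of 0]
  proof eventually_elim
    case (elim n)
    have "(\<lambda>\<omega>. (A n \<omega>, B n \<omega>)) \<in> borel_measurable (M n)"
      using A[OF elim] B[OF elim] by (simp add: borel_prod[symmetric])
    then show ?case
      using fm by (simp add: integral_distr F_def)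
  qed
  show "(\<lambda>n. integral\<^sup>L (distr (M n) borel (\<lambda>\<omega>. (A n \<omega>, B n \<omega>))) f)
      \<longlonglongrightarrow> integral\<^sup>L (distr N borel (\<lambda>\<omega>. (X \<omega>, g (X \<omega>)))) f"
    unfolding eq[symmetric] by (rule Lim_transform_eventually[OF F ev])
qed

theorem theorem1p1:
  fixes m :: nat and k :: "nat \<Rightarrow> nat"
    and M :: "nat \<Rightarrow> 'a measure" and C :: "nat \<Rightarrow> nat \<Rightarrow> 'a \<Rightarrow> nat"
    and N :: "'b measure" and X :: "'b \<Rightarrow> real"
  assumes "m > 0"
    and "\<And>n. n > 0 \<Longrightarrow> k n \<ge> m"
    and "m = 1 \<Longrightarrow> (\<lambda>n. real (k n)) \<in> o(\<lambda>n. ln (real n))"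
    and "m \<ge> 2 \<Longrightarrow> (\<lambda>n. real (k n)) \<in> o(\<lambda>n. ln (real n) / ln (ln (real n)))"
    and "\<And>n. n > 0 \<Longrightarrow> coupon_collector (M n) n (C n)"
    and "gumbel_distributed N X (- ln (fact (m - 1))) 1"
  shows "converges_in_distribution M
     (\<lambda>n \<omega>.
        ((real (collection_time n m (\<lambda>i. C n i \<omega>)) - real n * ln (real n)
            - (real m - 1) * real n * ln (ln (real n))) / real n,
         fact (k n) * real (kton_count n m (k n) (\<lambda>i. C n i \<omega>))
            / ln (real n) ^ (k n - m + 1)))
     N (\<lambda>\<omega>. (X \<omega>, exp (- X \<omega>)))"
proof -
  have kL: "(\<lambda>n. real (k n) / ln (real n)) \<longlonglongrightarrow> 0"
    and kLL: "(\<lambda>n. (real m - 1) * real (k n) * ln (ln (real n)) / ln (real n)) \<longlonglongrightarrow> 0"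
  proof -
    have "(\<lambda>n. real (k n)) \<in> o(\<lambda>n. ln (real n))"
    proof (cases "m = 1")
      case False
      then have "(\<lambda>n. real (k n)) \<in> o(\<lambda>n. ln (real n) / ln (ln (real n)))"
        using assms by auto
      also have "(\<lambda>n. ln (real n) / ln (ln (real n))) \<in> O(\<lambda>n. ln (real n))"
        by real_asymp
      finally show ?thesis .
    qed (use assms in auto)
    then show "(\<lambda>n. real (k n) / ln (real n)) \<longlonglongrightarrow> 0"
      by (rule smalloD_tendsto)
    show "(\<lambda>n. (real m - 1) * real (k n) * ln (ln (real n)) / ln (real n)) \<longlonglongrightarrow> 0"
    proof (cases "m = 1")
      case False
      then have "(\<lambda>n. real (k n) / (ln (real n) / ln (ln (real n)))) \<longlonglongrightarrow> 0"
        using assms by (intro smalloD_tendsto) auto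
      from tendsto_mult[OF tendsto_const this, of "real m - 1"] show ?thesis
        by (simp add: mult.assoc)
    qed simp
  qed
  have km: "\<forall>\<^sub>F n in sequentially. m \<le> k n"
    using eventually_gt_at_top[of 0] by eventually_elim (rule assms)
  have N: "prob_space N" "X \<in> borel_measurable N" "cdf (distr N borel X) = gumbel_cdf (- ln (fact (m - 1))) 1"
    using assms(6) by (auto simp: gumbel_distributed_def)
  let ?A = "\<lambda>n \<omega>. norm_time m n (\<lambda>i. C n i \<omega>)"
  let ?B = "\<lambda>n \<omega>. fact (k n) * real (kton_count n m (k n) (\<lambda>i. C n i \<omega>)) / ln (real n) ^ (k n - m + 1)"
  have "converges_in_distribution M (\<lambda>n \<omega>. (?A n \<omega>, ?B n \<omega>)) N (\<lambda>\<omega>. (X \<omega>, exp (- X \<omega>)))"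
  proof (rule converges_in_distribution_graph[where g="\<lambda>x. exp (- x)"])
    fix n :: nat assume "n > 0"
    then interpret coupon_collector "M n" n "C n" by (rule assms)
    show "prob_space (M n)" by unfold_locales
    show "?A n \<in> borel_measurable (M n)" "?B n \<in> borel_measurable (M n)"
      unfolding norm_time_def by measurable
  next
    show "(\<lambda>n. measure (M n) {\<omega> \<in> space (M n). ?A n \<omega> \<le> x}) \<longlonglongrightarrow> cdf (distr N borel X) x" for x
      unfolding N by (rule norm_time_cdf_tendsto[OF assms(5,1)])
  next
    fix d :: real assume "d > 0"
    have "\<forall>\<^sub>F n in sequentially. measure (M n) {\<omega> \<in> space (M n).
        \<bar>real (kton_count n m (k n) (\<lambda>i. C n i \<omega>)) / kton_scale m n (k n) - exp (- ?A n \<omega>)\<bar> \<ge> d}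
      = measure (M n) {\<omega> \<in> space (M n). \<bar>?B n \<omega> - exp (- ?A n \<omega>)\<bar> \<ge> d}"
      using km by eventually_elim (simp add: kton_scale_def Suc_diff_le mult.commute)
    with kton_count_close[OF assms(5,1) km kL kLL \<open>d > 0\<close>]
    show "(\<lambda>n. measure (M n) {\<omega> \<in> space (M n). \<bar>?B n \<omega> - exp (- ?A n \<omega>)\<bar> \<ge> d}) \<longlonglongrightarrow> 0"
      by (rule Lim_transform_eventually)
  qed (use N in \<open>auto intro!: continuous_intros\<close>)
  then show ?thesis
    by (simp only: norm_time_def)
qed

end
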